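(* A $k$-tableau in $\mathbf T(A_n)$ is in $\pi_k(A_n)$ if and only if it is of the form $$T^k=((\cdots((((T_1^{op}*_{i_1}j_1)*T_2)^{op}*_{i_2}j_2)*T_3)^{op}\cdots)^{op}*_{i_k}j_k)*T_{k+1}$$ for some integers $1<j_1<\cdots<j_k\le n+1$ and some suitable integers $i_1,\dots,i_k$ (i.e. such that each attachment makes sense), where for $1\le h\le k+1$, $T_h$ is the one-column tableau with entries $J_h=\{j_{h-1}+1,\dots,j_h-1\}$ in the natural order ($j_0=0$, $j_{k+1}=n+2$). Moreover, the order in $\pi_k(A_n)$ is the one induced by the lexicographic order between sequences of pairs $((j_1,i_1),\dots,(j_k,i_k))$, where $(j_t,i_t)<(j'_t,i'_t)$ iff either $j_t<j'_t$, or $j_t=j'_t$ and $i_t>i'_t$.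
   Context: **Operations.** $T*T'$ is obtained by attaching $T'$ vertically below $T$; $T*_ih$ is obtained by attaching the one-box tableau with entry $h$ to the $i$-th row of $T$; $T^{op}$ is obtained from $T$ by reversing the order of its rows. **Tableaux.** $\mathbf T^{\mathbf k}(A_n)$ is the set of $k$-tableaux: tableaux with $n+1-k$ (left-aligned, nonempty, of arbitrary lengths) rows, filled bijectively with $1,\dots,n+1$, entries increasing along each row; $\mathbf T(A_n)=\bigcup_k\mathbf T^{\mathbf k}(A_n)$. A $k$-tableau represents the codimension-$k$ facet (of the braid arrangement $\{x_i=x_j\}$ in $\mathbb R^{n+1}$) of points $(x_1,\dots,x_{n+1})$ with $x_i=x_j$ iff $i,j$ are in the same row, and $x_i<x_j$ iff the row of $i$ precedes the row of $j$. $T\prec T'$ means $\mathrm{clos}(F)\supseteq F'$ for the represented facets. *Moving.* $M_{j,r}(T)$ is obtained by moving the entry $r$ of $T$ to the $j$-th row; for $j=0$, $r$ becomes the only entry of a new first row. If $r$ is in the $i$-th row, $M_r(T)=\{M_{j,r}(T)\}_{0<j<i}$, ordered by decreasing $j$. *Projection, inclusion.* $p_{n,m}:\mathbf T(A_n)\to\mathbf T(A_m)$ forgets the entries $\ge m+2$ (deleting empty rows); $m_T$ is the minimum integer $0\le m\le n$ such that $p_{n,m}(T)$ is a tableau of the same dimension $k$ as $T$. $i_{m,n}:\mathbf T(A_m)\to\mathbf T(A_n)$ attaches below $T$ the one-box rows $m+2,\dots,n+1$ in this order. *T-blocks.* Let $e_i(T)$ be the first entry of the $i$-th row of the $k$-tableau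 $T$. If $m_T<n$ and $m_T+1-k<h\le n+1-k$, set $\mathcal Q_{n,h}(T)=\bigcup_{m_T+1-k<i\le h}M_{e_i(T)}(T_{i-1})$, where $T_{m_T+1-k}=T$, $T_i=M_{0,e_i(T)}(T_{i-1})$; it is ordered by the order of each $M_{e_i(T)}(T_{i-1})$, with those for smaller $i$ first. *Reflections.* For $T'\prec T$, $r_T(T')$ is the tableau of the facet opposite to (symmetric to) that of $T'$ with respect to the affine span of the facet of $T$: the rows of $T'$ composing each row of $T$ are listed in reverse order. If $\mathcal Q_{n,h}(T)=\{T_1,\dots,T_p\}$ in order, $r_{\mathcal Q_{n,h}(T)}(\overline T)=\overline T_p$, where $\overline T_0=\overline T$ and $\overline T_i=r_{T_i}(\overline T_{i-1})$ if $T_i\succ\overline T_{i-1}$, $\overline T_i=\overline T_{i-1}$ otherwise. *The ordered sets $\pi_k(A_n)$.* $\pi_0(A_n)$ consists of the one-column tableau with entries $1,\dots,n+1$ in increasing order. Given the ordered set $\pi_k(A_{n-1})=\{T_1,T_2,\dots\}$, set $T_{i,1}=i_{n-1,n}(T_i)$ and $T_{i,j}=r_{\mathcal Q_{n,n+1-k}(T_{j-1,j-1})}(T_{i,j-1})$ for $2\le j\le i$; then $\pi_{k+1}(A_n)=\bigcup_i\mathcal Q_{n,n+1-k}(T_{i,i})$, ordered by $i$ first and then by the order inside each block. *)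

theory Defs
  imports "HOL-Analysis.Function_Topology"
begin

text \<open>
  A tableau is the list of its rows, from top to bottom; a row is the list of its entries, from left
  to right. Rows are numbered from 1, so row \<open>i\<close> of \<open>T\<close> is \<open>T ! (i - 1)\<close>.
  Finite ordered sets are lists, and ordered unions are concatenations.
\<close>

type_synonym tableau = "nat list list"

definition tableaux :: "nat \<Rightarrow> nat \<Rightarrow> tableau set" where
  \<comment> \<open>The \<open>k\<close>-tableaux of \<open>A\<^sub>n\<close>, which have \<open>n + 1 - k\<close> rows; the set is empty for \<open>k > n\<close>.\<close>
  "tableaux n k = {T. length T + k = n + 1 \<and> [] \<notin> set T \<and> (\<forall>R\<in>set T. sorted_wrt (<) R)
     \<and> distinct (concat T) \<and> set (concat T) = {1..n + 1}}"

definition codim :: "nat \<Rightarrow> tableau \<Rightarrow> nat" where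
  \<comment> \<open>The \<open>k\<close> for which a tableau of \<open>A\<^sub>n\<close> is a \<open>k\<close>-tableau.\<close>
  "codim n T = n + 1 - length T"

definition column :: "nat \<Rightarrow> nat \<Rightarrow> tableau" where
  \<comment> \<open>The one-column tableau with entries \<open>a, \<dots>, b - 1\<close>; it has no rows if \<open>b \<le> a\<close>.\<close>
  "column a b = map (\<lambda>x. [x]) [a..<b]"

definition row_index :: "tableau \<Rightarrow> nat \<Rightarrow> nat" where
  "row_index T r = Suc (length (takeWhile (\<lambda>R. r \<notin> set R) T))"

definition first_entry :: "tableau \<Rightarrow> nat \<Rightarrow> nat" where
  "first_entry T i = hd (T ! (i - 1))"


subsection \<open>Operations\<close>

definition attach_below :: "tableau \<Rightarrow> tableau \<Rightarrow> tableau" where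
  "attach_below T T' = T @ T'"

definition attach_box :: "tableau \<Rightarrow> nat \<Rightarrow> nat \<Rightarrow> tableau" where
  \<comment> \<open>\<open>T *\<^sub>i h\<close>, which makes sense for \<open>1 \<le> i \<le> length T\<close>.\<close>
  "attach_box T i h = T[i - 1 := T ! (i - 1) @ [h]]"

definition opposite :: "tableau \<Rightarrow> tableau" where
  "opposite T = rev T"


subsection \<open>Facets and reflections\<close>

definition facet :: "nat \<Rightarrow> tableau \<Rightarrow> (nat \<Rightarrow> real) set" where
  \<comment> \<open>Points of \<open>\<real>\<^bsup>n+1\<^esup>\<close> are functions vanishing outside the coordinates \<open>1, \<dots>, n + 1\<close>. These form
    a closed subspace on which the product topology is the Euclidean one.\<close>
  "facet n T = {x. (\<forall>i. i \<notin> {1..n + 1} \<longrightarrow> x i = 0)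
     \<and> (\<forall>i\<in>{1..n + 1}. \<forall>j\<in>{1..n + 1}.
          (x i = x j \<longleftrightarrow> row_index T i = row_index T j)
        \<and> (x i < x j \<longleftrightarrow> row_index T i < row_index T j))}"

definition prec :: "nat \<Rightarrow> tableau \<Rightarrow> tableau \<Rightarrow> bool" where
  "prec n T T' \<longleftrightarrow> facet n T' \<subseteq> closure (facet n T)"

definition reflect :: "tableau \<Rightarrow> tableau \<Rightarrow> tableau" where
  \<comment> \<open>\<open>r\<^sub>T(T')\<close>, used only for \<open>T' \<prec> T\<close>. In that case each row of \<open>T'\<close> is contained in a row of \<open>T\<close>.\<close>
  "reflect T T' = concat (map (\<lambda>R. rev (filter (\<lambda>S. set S \<subseteq> set R) T')) T)"

definition reflect_list :: "nat \<Rightarrow> tableau list \<Rightarrow> tableau \<Rightarrow> tableau" where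
  "reflect_list n Q T = foldl (\<lambda>S U. if prec n S U then reflect U S else S) T Q"


subsection \<open>Moving, projection, inclusion\<close>

definition move :: "nat \<Rightarrow> nat \<Rightarrow> tableau \<Rightarrow> tableau" where
  \<comment> \<open>\<open>M\<^bsub>j,r\<^esub>(T)\<close>; the old row of \<open>r\<close> disappears if \<open>r\<close> was its only entry.\<close>
  "move j r T = (let U = map (removeAll r) T in
     filter (\<lambda>R. R \<noteq> []) (if j = 0 then [r] # U else U[j - 1 := insort r (U ! (j - 1))]))"

definition moves :: "nat \<Rightarrow> tableau \<Rightarrow> tableau list" where
  "moves r T = map (\<lambda>j. move j r T) (rev [1..<row_index T r])"

definition proj :: "nat \<Rightarrow> tableau \<Rightarrow> tableau" where
  "proj m T = filter (\<lambda>R. R \<noteq> []) (map (filter (\<lambda>x. x \<le> m + 1)) T)"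

definition incl :: "nat \<Rightarrow> nat \<Rightarrow> tableau \<Rightarrow> tableau" where
  "incl m n T = attach_below T (column (m + 2) (n + 2))"

definition m_of :: "nat \<Rightarrow> tableau \<Rightarrow> nat" where
  "m_of n T = (LEAST m. m \<le> n \<and> proj m T \<in> tableaux m (codim n T))"


subsection \<open>Blocks and the ordered sets \<open>\<pi>\<^sub>k(A\<^sub>n)\<close>\<close>

definition block :: "nat \<Rightarrow> nat \<Rightarrow> tableau \<Rightarrow> tableau list" where
  \<comment> \<open>\<open>\<Q>\<^bsub>n,h\<^esub>(T)\<close>, meaningful for \<open>m\<^sub>T < n\<close> and \<open>a < h \<le> n + 1 - k\<close> with \<open>a = m\<^sub>T + 1 - k\<close>. In the
    summand of index \<open>i\<close> the inner fold is \<open>T\<^bsub>i-1\<^esub>\<close>; all first entries are those of the original \<open>T\<close>.\<close>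
  "block n h T = (let a = m_of n T + 1 - codim n T in
     concat (map (\<lambda>i. moves (first_entry T i)
                        (foldl (\<lambda>S l. move 0 (first_entry T l) S) T [a + 1..<i]))
       [a + 1..<h + 1]))"

primrec refl_seq :: "nat \<Rightarrow> nat \<Rightarrow> tableau list \<Rightarrow> nat \<Rightarrow> nat \<Rightarrow> tableau" where
  \<comment> \<open>For \<open>Ts = \<pi>\<^sub>k(A\<^bsub>n-1\<^esub>)\<close>, \<open>refl_seq n k Ts j i\<close> is \<open>T\<^bsub>i+1,j+1\<^esub>\<close>: the
    indices start at 0, and they come in the opposite order.\<close>
  "refl_seq n k Ts 0 = (\<lambda>i. incl (n - 1) n (Ts ! i))"
| "refl_seq n k Ts (Suc j) =
     (\<lambda>i. reflect_list n (block n (n + 1 - k) (refl_seq n k Ts j j)) (refl_seq n k Ts j i))"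

primrec polar :: "nat \<Rightarrow> nat \<Rightarrow> tableau list" where
  \<comment> \<open>\<open>polar k n\<close> is \<open>\<pi>\<^sub>k(A\<^sub>n)\<close>. There are no \<open>k\<close>-tableaux of \<open>A\<^sub>0\<close> for \<open>k > 0\<close>.\<close>
  "polar 0 n = [column 1 (n + 2)]"
| "polar (Suc k) n = (if n = 0 then [] else
     concat (map (\<lambda>i. block n (n + 1 - k) (refl_seq n k (polar k (n - 1)) i i))
       [0..<length (polar k (n - 1))]))"

definition precedes :: "'a list \<Rightarrow> 'a \<Rightarrow> 'a \<Rightarrow> bool" where
  "precedes xs a b \<longleftrightarrow> (\<exists>p q. p < q \<and> q < length xs \<and> xs ! p = a \<and> xs ! q = b)"


subsection \<open>The iterated form\<close>

text \<open>A sequence \<open>((j\<^sub>1,i\<^sub>1), \<dots>, (j\<^sub>k,i\<^sub>k))\<close> is a list of pairs.\<close>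

definition jval :: "nat \<Rightarrow> (nat \<times> nat) list \<Rightarrow> nat \<Rightarrow> nat" where
  \<comment> \<open>\<open>j\<^sub>t\<close> for \<open>0 \<le> t \<le> k + 1\<close>, with \<open>j\<^sub>0 = 0\<close> and \<open>j\<^bsub>k+1\<^esub> = n + 2\<close>\<close>
  "jval n ps t = (0 # map fst ps @ [n + 2]) ! t"

definition ival :: "(nat \<times> nat) list \<Rightarrow> nat \<Rightarrow> nat" where
  "ival ps t = snd (ps ! (t - 1))"

definition col_piece :: "nat \<Rightarrow> (nat \<times> nat) list \<Rightarrow> nat \<Rightarrow> tableau" where
  \<comment> \<open>The column \<open>T\<^sub>h\<close>, which may be empty for \<open>h > 1\<close>.\<close>
  "col_piece n ps h = column (jval n ps (h - 1) + 1) (jval n ps h)"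

primrec iter_form :: "nat \<Rightarrow> (nat \<times> nat) list \<Rightarrow> nat \<Rightarrow> tableau" where
  "iter_form n ps 0 = col_piece n ps 1"
| "iter_form n ps (Suc t) =
     attach_below
       (attach_box (opposite (iter_form n ps t)) (ival ps (Suc t)) (jval n ps (Suc t)))
       (col_piece n ps (t + 2))"

definition full_form :: "nat \<Rightarrow> (nat \<times> nat) list \<Rightarrow> tableau" where
  "full_form n ps = iter_form n ps (length ps)"

definition admissible :: "nat \<Rightarrow> nat \<Rightarrow> (nat \<times> nat) list \<Rightarrow> bool" where
  \<comment> \<open>The last conjunct says that each attachment is made to an existing row.\<close>
  "admissible n k ps \<longleftrightarrow> length ps = k
     \<and> sorted_wrt (<) (map fst ps) \<and> (\<forall>j\<in>set (map fst ps). 1 < j \<and> j \<le> n + 1)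
     \<and> (\<forall>t\<in>{1..k}. 1 \<le> ival ps t \<and> ival ps t \<le> length (opposite (iter_form n ps (t - 1))))"

definition pair_order :: "((nat \<times> nat) \<times> (nat \<times> nat)) set" where
  "pair_order = {((j, i), (j', i')). j < j' \<or> (j = j' \<and> i > i')}"

end

theory Submission
  imports Defs
begin

text \<open>
  The iterated form of \<open>((j\<^sub>1,i\<^sub>1),\<dots>,(j\<^sub>k,i\<^sub>k))\<close> is determined by its set of rows, so the iterated forms correspond
  to the set partitions of \<open>{1,\<dots>,n+1}\<close> into \<open>n + 1 - k\<close> blocks, the \<open>j\<^sub>t\<close> being the entries that are not least
  in their block. In \<open>\<pi>\<^bsub>k+1\<^esub>(A\<^sub>n)\<close> the block of \<open>T\<^bsub>i,i\<^esub>\<close> extends the sequence of the \<open>i\<close>-th member of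
  \<open>\<pi>\<^sub>k(A\<^bsub>n-1\<^esub>)\<close> by one more pair, provided that \<open>T\<^bsub>i,i\<^esub>\<close> arises from \<open>T\<^bsub>i,1\<^esub>\<close> by reversing the rows
  that precede the final column of the entries greater than \<open>j\<^sub>k\<close>. To see this, note that a reflection in a
  tableau of codimension one more changes \<open>T\<^bsub>i,j\<^esub>\<close> only if this tableau merges two adjacent rows, and then
  it exchanges them. The merges that occur before the block of \<open>T\<^bsub>i,i\<^esub>\<close> are exactly those of two rows with
  least entries \<open>e < m < j\<^sub>k\<close>. They come in the order of increasing \<open>m\<close>, and for fixed \<open>m\<close> in the order
  in which the rows of the smaller entries \<open>e\<close> have to be passed by the row of \<open>m\<close>, so their composition
  is the bubble sort that reverses these rows.
\<close>

subsection \<open>Set partitions\<close>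

text \<open>A set partition is encoded by the function sending each entry to the least entry of its block, the
  root of the block; all numbers that are not entries are fixed.\<close>

definition labelling :: "(nat \<Rightarrow> nat) \<Rightarrow> bool" where
  "labelling p \<longleftrightarrow> (\<forall>x. p x \<le> x \<and> p (p x) = p x \<and> (0 < x \<longrightarrow> 0 < p x))"

text \<open>The roots in the order in which their blocks appear as rows of the iterated form: an entry that opens
  a block is appended below, any other entry reverses the rows.\<close>

fun root_order :: "(nat \<Rightarrow> nat) \<Rightarrow> nat \<Rightarrow> nat list" where
  "root_order p 0 = []"
| "root_order p (Suc m) = (if p (Suc m) = Suc m then root_order p m @ [Suc m] else rev (root_order p m))"

definition row :: "(nat \<Rightarrow> nat) \<Rightarrow> nat \<Rightarrow> nat \<Rightarrow> nat list" where
  "row p m r = filter (\<lambda>x. p x = r) [1..<Suc m]"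

definition tab :: "(nat \<Rightarrow> nat) \<Rightarrow> nat \<Rightarrow> tableau" where
  "tab p m = map (row p m) (root_order p m)"

text \<open>For a nonroot \<open>x = j\<^sub>t\<close> this is \<open>i\<^sub>t\<close>. Roots get the code \<open>0\<close> because a first difference at which only
  one side has a nonroot makes that side smaller, as a larger \<open>i\<^sub>t\<close> does.\<close>

definition code :: "(nat \<Rightarrow> nat) \<Rightarrow> nat \<Rightarrow> nat" where
  "code p x = (if p x = x then 0
     else Suc (length (takeWhile (\<lambda>r. r \<noteq> p x) (rev (root_order p (x - 1))))))"

definition nonroots :: "(nat \<Rightarrow> nat) \<Rightarrow> nat set" where
  "nonroots p = {x. p x \<noteq> x}"

text \<open>This is \<open>j\<^sub>k\<close>; the value for \<open>k = 0\<close> is \<open>1\<close>, since the entry \<open>1\<close> is always a root.\<close>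

definition max_nonroot :: "(nat \<Rightarrow> nat) \<Rightarrow> nat" where
  "max_nonroot p = Max (insert 1 (nonroots p))"

text \<open>Agreement below \<open>x\<close> makes the root orders below \<open>x\<close> coincide,
  so both codes at \<open>x\<close> refer to the same list. For partitions with equally many
  nonroots this becomes the lexicographic order of the sequences of pairs.\<close>

definition before :: "(nat \<Rightarrow> nat) \<Rightarrow> (nat \<Rightarrow> nat) \<Rightarrow> bool" where
  "before p q \<longleftrightarrow> (\<exists>x. (\<forall>y<x. p y = q y) \<and> code q x < code p x)"

text \<open>Inverse to \<open>code\<close>: the pair \<open>(j, i)\<close> gives \<open>j\<close>
  the label at place \<open>i\<close> of the reversed root order, counted from 1.\<close>

definition insert_entry :: "(nat \<Rightarrow> nat) \<Rightarrow> nat \<Rightarrow> nat \<Rightarrow> (nat \<Rightarrow> nat)" where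
  "insert_entry p j i = p(j := rev (root_order p (j - 1)) ! (i - 1))"

text \<open>All ways to append a pair to a partition with \<open>k\<close> nonroots, in the order of
  pairs: \<open>j\<close> increases and \<open>i\<close> decreases. The exclusive bound
  \<open>j - k\<close> comes from the \<open>j - 1 - k\<close> roots below \<open>j\<close>.\<close>

definition children :: "nat \<Rightarrow> nat \<Rightarrow> (nat \<Rightarrow> nat) \<Rightarrow> (nat \<Rightarrow> nat) list" where
  "children n k p = concat (map (\<lambda>j. map (insert_entry p j) (rev [1..<j - k])) [Suc (max_nonroot p)..<n + 2])"

text \<open>The recursion of \<open>polar\<close> transferred to partitions: each block becomes the
  list of children of a partition.\<close>

primrec labellings :: "nat \<Rightarrow> nat \<Rightarrow> (nat \<Rightarrow> nat) list" where
  "labellings 0 n = [id]"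
| "labellings (Suc k) n = concat (map (children n k) (labellings k (n - 1)))"

definition code_seq :: "(nat \<Rightarrow> nat) \<Rightarrow> nat \<Rightarrow> (nat \<times> nat) list" where
  "code_seq p n = map (\<lambda>x. (x, code p x)) (filter (\<lambda>x. p x \<noteq> x) [1..<n + 2])"

text \<open>Each nonroot lowers the number of blocks by one, so these are the partitions of
  \<open>{1..n + 1}\<close> into \<open>n + 1 - k\<close> blocks.\<close>

definition partitions :: "nat \<Rightarrow> nat \<Rightarrow> (nat \<Rightarrow> nat) set" where
  "partitions n k = {p. labelling p \<and> nonroots p \<subseteq> {..n + 1} \<and> card (nonroots p) = k}"

section \<open>Roots, codes and the order of partitions\<close>

lemma labellingD:
  assumes "labelling p"
  shows "p x \<le> x" "p (p x) = p x" "0 < x \<Longrightarrow> 0 < p x" "p 0 = 0" "p (Suc 0) = Suc 0"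
proof -
  show *: "p x \<le> x" "p (p x) = p x" "0 < x \<Longrightarrow> 0 < p x" for x
    using assms by (auto simp: labelling_def)
  show "p 0 = 0" using *(1)[of 0] by simp
  show "p (Suc 0) = Suc 0" using *(1)[of "Suc 0"] *(3)[of "Suc 0"] by simp
qed

lemma set_root_order: "set (root_order p m) = {x \<in> {1..m}. p x = x}"
  by (induction m) (auto simp: le_Suc_eq)

lemma distinct_root_order: "distinct (root_order p m)"
  by (induction m) (auto simp: set_root_order)

lemma length_root_order: "length (root_order p m) + card (nonroots p \<inter> {1..m}) = m"
proof (induction m)
  case (Suc m)
  have "nonroots p \<inter> {1..Suc m} = (if p (Suc m) = Suc m then nonroots p \<inter> {1..m}
      else insert (Suc m) (nonroots p \<inter> {1..m}))"
    by (auto simp: nonroots_def le_Suc_eq)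
  with Suc show ?case by auto
qed simp

lemma root_order_cong:
  assumes "\<And>y. y \<le> m \<Longrightarrow> p y = q y"
  shows "root_order p m = root_order q m"
  using assms by (induction m) auto

lemma code_cong:
  assumes "\<And>y. y \<le> x \<Longrightarrow> p y = q y"
  shows "code p x = code q x"
proof -
  have "root_order p (x - 1) = root_order q (x - 1)"
    by (rule root_order_cong) (use assms in auto)
  then show ?thesis using assms[of x] by (simp add: code_def)
qed

lemma length_takeWhile_less:
  assumes "x \<in> set xs" "\<not> P x"
  shows "length (takeWhile P xs) < length xs"
  using assms by (induction xs) auto

text \<open>A label \<open>p x \<noteq> x\<close> is itself a root below \<open>x\<close>, so the
  search in \<open>code\<close> stops inside the list and returns its position, counted from
  1.\<close>

lemma code_nth:
  assumes "labelling p" "p x \<noteq> x"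
  shows "0 < code p x" "code p x \<le> length (root_order p (x - 1))"
    "rev (root_order p (x - 1)) ! (code p x - 1) = p x"
proof -
  let ?L = "rev (root_order p (x - 1))"
  have "x > 0" using assms labellingD(4) by (cases x) auto
  have "p x < x" using assms labellingD(1)[OF assms(1), of x] by simp
  then have "p x \<in> set ?L"
    using \<open>x > 0\<close> labellingD(2,3)[OF assms(1), of x] by (simp add: set_root_order)
  then have *: "length (takeWhile (\<lambda>r. r \<noteq> p x) ?L) < length ?L"
    by (rule length_takeWhile_less) simp
  show "0 < code p x" using assms by (simp add: code_def)
  show "code p x \<le> length (root_order p (x - 1))" using * assms by (simp add: code_def)
  show "?L ! (code p x - 1) = p x"
    using nth_length_takeWhile[OF *] assms by (simp add: code_def)
qed

text \<open>The code \<open>0\<close> marks roots, and a positive code is a position in the reversed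
  root order, which is common to \<open>p\<close> and \<open>q\<close>.\<close>

lemma code_eqD:
  assumes "labelling p" "labelling q" "\<And>y. y < x \<Longrightarrow> p y = q y" "code p x = code q x"
  shows "p x = q x"
proof (cases "p x = x")
  case True
  then show ?thesis using assms(4) by (auto simp: code_def split: if_splits)
next
  case False
  then have "q x \<noteq> x" using assms(4) by (auto simp: code_def split: if_splits)
  have "x > 0" using False labellingD(4)[OF assms(1)] by (cases x) auto
  then have "root_order p (x - 1) = root_order q (x - 1)"
    by (intro root_order_cong assms(3)) auto
  then show ?thesis
    using code_nth(3)[OF assms(1) False] code_nth(3)[OF assms(2) \<open>q x \<noteq> x\<close>] assms(4) by simp
qed

lemma before_irrefl: "\<not> before p p"
  by (simp add: before_def)

lemma before_trans:
  assumes "before p q" "before q r"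
  shows "before p r"
proof -
  obtain x where x: "\<And>y. y < x \<Longrightarrow> p y = q y" "code q x < code p x"
    using assms(1) by (auto simp: before_def)
  obtain z where z: "\<And>y. y < z \<Longrightarrow> q y = r y" "code r z < code q z"
    using assms(2) by (auto simp: before_def)
  consider "x < z" | "z < x" | "x = z" by linarith
  then show ?thesis
  proof cases
    case 1
    then have "code q x = code r x" by (intro code_cong z(1)) auto
    then show ?thesis unfolding before_def using x z 1
      by (intro exI[of _ x]) auto
  next
    case 2
    then have "code p z = code q z" by (intro code_cong x(1)) auto
    then show ?thesis unfolding before_def using x z 2
      by (intro exI[of _ z]) auto
  next
    case 3
    then show ?thesis unfolding before_def using x z
      by (intro exI[of _ x]) auto
  qed
qed

text \<open>The least argument at which the labels differ also separates the codes.\<close>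

lemma before_total:
  assumes "labelling p" "labelling q" "p \<noteq> q"
  shows "before p q \<or> before q p"
proof -
  obtain x where x: "p x \<noteq> q x" "\<And>y. y < x \<Longrightarrow> p y = q y"
    using assms(3) exists_least_iff[of "\<lambda>x. p x \<noteq> q x"] by auto
  then have "code p x \<noteq> code q x" using code_eqD[OF assms(1,2)] by blast
  then show ?thesis unfolding before_def using x(2) by (metis linorder_neqE_nat)
qed

section \<open>Tableaux of partitions, built entry by entry\<close>

lemma tab_Suc_root:
  assumes "labelling p" "p (Suc m) = Suc m"
  shows "tab p (Suc m) = tab p m @ [[Suc m]]"
proof -
  have "row p (Suc m) (Suc m) = [Suc m]"
  proof -
    have "p x \<noteq> Suc m" if "x \<le> m" for x
      using labellingD(1)[OF assms(1), of x] that by linarith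
    then show ?thesis using assms by (simp add: row_def)
  qed
  moreover have "map (row p (Suc m)) (root_order p m) = map (row p m) (root_order p m)"
    using assms by (auto simp: row_def set_root_order)
  ultimately show ?thesis using assms by (simp add: tab_def)
qed

text \<open>One round of the iterated form: the new entry reverses the rows and joins the row of its
  root. The roots are distinct, so only the row at the place given by the code grows.\<close>

lemma tab_Suc_nonroot:
  assumes "labelling p" "p (Suc m) \<noteq> Suc m"
  shows "tab p (Suc m) = attach_box (rev (tab p m)) (code p (Suc m)) (Suc m)"
proof -
  let ?L = "rev (root_order p m)" and ?c = "code p (Suc m) - 1"
  have c: "?c < length ?L" "?L ! ?c = p (Suc m)"
    using code_nth[OF assms] by auto
  have d: "distinct ?L" by (simp add: distinct_root_order)
  have "map (row p (Suc m)) ?L = (map (row p m) ?L)[?c := map (row p m) ?L ! ?c @ [Suc m]]"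
  proof (rule nth_equalityI)
    fix i assume "i < length (map (row p (Suc m)) ?L)"
    then have i: "i < length ?L" by simp
    have "?L ! i = p (Suc m) \<longleftrightarrow> i = ?c"
      using nth_eq_iff_index_eq[OF d i c(1)] c(2) by auto
    then show "map (row p (Suc m)) ?L ! i
        = (map (row p m) ?L)[?c := map (row p m) ?L ! ?c @ [Suc m]] ! i"
      using i c by (auto simp: row_def nth_list_update simp del: rev_nth)
  qed simp
  then show ?thesis using assms c by (simp add: tab_def attach_box_def rev_map)
qed

lemma tab_append_column:
  assumes "labelling p" "a \<le> b" "\<And>x. a < x \<Longrightarrow> x \<le> b \<Longrightarrow> p x = x"
  shows "tab p b = tab p a @ column (Suc a) (Suc b)"
  using assms(2,3)
proof (induction b rule: dec_induct)
  case (step b)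
  then show ?case using tab_Suc_root[OF assms(1), of b] by (simp add: column_def)
qed (simp add: column_def)

subsection \<open>Reflections that exchange two adjacent rows\<close>

lemma row_index_unique:
  assumes "r \<in> set R" "\<And>R'. R' \<in> set A \<Longrightarrow> r \<notin> set R'"
  shows "row_index (A @ R # B) r = Suc (length A)"
  using assms by (induction A) (auto simp: row_index_def)

lemma row_index_append:
  "row_index (A @ B) r = (if \<exists>R\<in>set A. r \<in> set R then row_index A r else length A + row_index B r)"
  by (induction A) (auto simp: row_index_def)

lemma row_index_Cons: "row_index (R # B) r = (if r \<in> set R then 1 else Suc (row_index B r))"
  by (simp add: row_index_def)

lemma row_index_nth:
  assumes "\<exists>R\<in>set T. r \<in> set R"
  shows "row_index T r - 1 < length T" "r \<in> set (T ! (row_index T r - 1))" "1 \<le> row_index T r"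
proof -
  have *: "length (takeWhile (\<lambda>R. r \<notin> set R) T) < length T"
    using assms by (induction T) auto
  then show "row_index T r - 1 < length T" by (simp add: row_index_def)
  show "r \<in> set (T ! (row_index T r - 1))" using nth_length_takeWhile[OF *] by (simp add: row_index_def)
  show "1 \<le> row_index T r" by (simp add: row_index_def)
qed

section \<open>Facets and their closures\<close>

lemma row_point_in_facet:
  "(\<lambda>i. if i \<in> {1..n + 1} then real (row_index T i) else 0) \<in> facet n T"
  by (auto simp: facet_def)

text \<open>Equality of two coordinates is a closed condition that holds on the facet of
  \<open>S\<close>, hence on its closure. The point of row indices in the facet of \<open>U\<close>
  therefore satisfies it.\<close>

lemma prec_coarsens:
  assumes "prec n S U" "x \<in> {1..n + 1}" "y \<in> {1..n + 1}" "row_index S x = row_index S y"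
  shows "row_index U x = row_index U y"
proof -
  let ?u = "\<lambda>i. if i \<in> {1..n + 1} then real (row_index U i) else 0"
  let ?C = "{f :: nat \<Rightarrow> real. f x = f y}"
  have "closed ?C"
    by (intro closed_Collect_eq continuous_on_product_coordinates)
  moreover have "facet n S \<subseteq> ?C" using assms by (auto simp: facet_def)
  ultimately have "closure (facet n S) \<subseteq> ?C" by (simp add: closure_minimal)
  then have "?u \<in> ?C" using assms(1) row_point_in_facet[of n U] by (auto simp: prec_def)
  then show ?thesis using assms by simp
qed

text \<open>A point \<open>u\<close> of the facet of \<open>U\<close> is approached by adding ever
  smaller multiples of the point of row indices of \<open>S\<close>. This separates the coordinates
  merged by \<open>U\<close> in the order of the rows of \<open>S\<close>, and by monotonicity it
  agrees with the order of the other coordinates.\<close>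

lemma prec_of_monotone:
  assumes "\<And>x y. x \<in> {1..n + 1} \<Longrightarrow> y \<in> {1..n + 1} \<Longrightarrow> row_index S x \<le> row_index S y
    \<Longrightarrow> row_index U x \<le> row_index U y"
  shows "prec n S U"
  unfolding prec_def
proof
  fix u assume u: "u \<in> facet n U"
  let ?s = "\<lambda>i. if i \<in> {1..n + 1} then real (row_index S i) else 0"
  let ?f = "\<lambda>m i. u i + inverse (real (Suc m)) * ?s i"
  have in_facet: "?f m \<in> facet n S" for m
  proof -
    have eq: "?f m x = ?f m y" if "x \<in> {1..n + 1}" "y \<in> {1..n + 1}" "row_index S x = row_index S y" for x y
    proof -
      have "row_index U x = row_index U y"
        using assms[of x y] assms[of y x] that by simp
      then have "u x = u y" using u that by (simp add: facet_def)
      then show ?thesis using that by simp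
    qed
    have less: "?f m x < ?f m y" if "x \<in> {1..n + 1}" "y \<in> {1..n + 1}" "row_index S x < row_index S y" for x y
    proof -
      have "row_index U x \<le> row_index U y"
        using assms[of x y] that by simp
      then have "u x \<le> u y" using u that by (auto simp: facet_def le_less)
      then show ?thesis using that by (intro add_le_less_mono mult_strict_left_mono) auto
    qed
    have "(?f m x = ?f m y \<longleftrightarrow> row_index S x = row_index S y)
        \<and> (?f m x < ?f m y \<longleftrightarrow> row_index S x < row_index S y)"
      if "x \<in> {1..n + 1}" "y \<in> {1..n + 1}" for x y
      using eq[OF that] less[OF that] less[OF that(2,1)]
      by (metis less_irrefl less_asym linorder_neqE_nat)
    then show ?thesis using u by (simp add: facet_def)
  qed
  have "?f \<longlonglongrightarrow> u"
  proof -
    have *: "(\<lambda>m. ?f m i) \<longlonglongrightarrow> u i" for i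
    proof -
      have "(\<lambda>m. u i + inverse (real (Suc m)) * ?s i) \<longlonglongrightarrow> u i + 0 * ?s i"
        by (intro tendsto_intros LIMSEQ_inverse_real_of_nat)
      then show ?thesis by simp
    qed
    \<comment> \<open>Coordinatewise convergence is convergence in the product topology, which is
      the topology of the function type.\<close>
    have "limitin (product_topology (\<lambda>i. euclidean) UNIV) ?f u sequentially"
      unfolding limitin_componentwise using * by (auto simp only: limitin_canonical_iff
        topspace_product_topology PiE_UNIV_domain topspace_euclidean extensional_UNIV UNIV_I Pi_UNIV
        eventually_True)
    then show ?thesis
      by (simp only: euclidean_product_topology limitin_canonical_iff)
  qed
  moreover have "\<forall>\<^sub>F m in sequentially. ?f m \<in> closure (facet n S)"
    by (intro always_eventually allI subsetD[OF closure_subset in_facet])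
  ultimately show "u \<in> closure (facet n S)"
    by (intro Lim_in_closed_set[OF closed_closure _ sequentially_bot])
qed

lemma filter_eq_single: "distinct xs \<Longrightarrow> x \<in> set xs \<Longrightarrow> filter (\<lambda>y. y = x) xs = [x]"
  by (induction xs) (auto simp: filter_empty_conv)

text \<open>Rows are disjoint and nonempty, so each row of the merged tableau other than
  \<open>R\<close> contains just one old row, namely itself, while \<open>R\<close> contains
  \<open>R1\<close> and \<open>R2\<close>. Only these two are reversed.\<close>

lemma adjacent_rows_swap:
  assumes S: "distinct (concat (A @ [R1, R2] @ B))" "[] \<notin> set (A @ [R1, R2] @ B)"
    "set (concat (A @ [R1, R2] @ B)) = {1..n + 1}"
    and R: "set R = set R1 \<union> set R2"
  shows "prec n (A @ [R1, R2] @ B) (A @ [R] @ B)"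
    "reflect (A @ [R] @ B) (A @ [R1, R2] @ B) = A @ [R2, R1] @ B"
proof -
  \<comment> \<open>Merging lowers the row index by one for all entries below \<open>R1\<close>,
    which is a monotone change.\<close>
  have index: "row_index (A @ [R] @ B) z = (if row_index (A @ [R1, R2] @ B) z \<le> Suc (length A)
      then row_index (A @ [R1, R2] @ B) z else row_index (A @ [R1, R2] @ B) z - 1)" for z
  proof (cases "\<exists>P\<in>set A. z \<in> set P")
    case True
    then show ?thesis using row_index_nth(1)[OF True] by (simp add: row_index_append)
  next
    case False
    moreover have "1 \<le> row_index B z" by (simp add: row_index_def)
    ultimately show ?thesis
      by (simp only: row_index_append row_index_Cons append_Cons append_Nil R Un_iff if_False) simp
  qed
  show "prec n (A @ [R1, R2] @ B) (A @ [R] @ B)"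
  proof (rule prec_of_monotone)
    fix x y
    assume "row_index (A @ [R1, R2] @ B) x \<le> row_index (A @ [R1, R2] @ B) y"
    then show "row_index (A @ [R] @ B) x \<le> row_index (A @ [R] @ B) y"
      unfolding index[of x] index[of y] by presburger
  qed
  define W where "W = A @ [R1, R2] @ B"
  have disjoint: "set P \<inter> set Q = {}" if "P \<in> set W" "Q \<in> set W" "P \<noteq> Q" for P Q
    using S(1) that unfolding W_def by (metis distinct_concat_iff)
  have nonempty: "set P \<noteq> {}" if "P \<in> set W" for P
    using S(2) that unfolding W_def by (metis set_empty)
  have "distinct (removeAll [] W)"
    using S(1)[folded W_def, unfolded distinct_concat_iff] by (rule conjunct1)
  then have "distinct W"
    using S(2)[folded W_def] by simp
  have single: "filter (\<lambda>P. set P \<subseteq> set Q) W = [Q]" if Q: "Q \<in> set W" for Q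
  proof -
    have "set P \<subseteq> set Q \<longleftrightarrow> P = Q" if "P \<in> set W" for P
    proof (cases "P = Q")
      case False
      then show ?thesis using disjoint[OF that Q False] nonempty[OF that] by (simp add: Int_absorb2 inf.absorb_iff1)
    qed simp
    then have "filter (\<lambda>P. set P \<subseteq> set Q) W = filter (\<lambda>P. P = Q) W"
      by (intro filter_cong[OF refl])
    also have "\<dots> = [Q]"
      using \<open>distinct W\<close> Q by (rule filter_eq_single)
    finally show ?thesis .
  qed
  have "\<not> set P \<subseteq> set R" if "P \<in> set A \<union> set B" for P
  proof -
    have P: "P \<in> set W" "P \<noteq> R1" "P \<noteq> R2" "R1 \<in> set W" "R2 \<in> set W"
      using \<open>distinct W\<close> that by (auto simp: W_def)
    then have "set P \<inter> set R = {}"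
      using disjoint[of P R1] disjoint[of P R2] by (simp add: R Int_Un_distrib)
    then show ?thesis using nonempty[OF P(1)] by (metis inf.absorb1)
  qed
  then have "filter (\<lambda>P. set P \<subseteq> set R) A = []" "filter (\<lambda>P. set P \<subseteq> set R) B = []"
    by (simp_all add: filter_empty_conv)
  then have merged: "filter (\<lambda>P. set P \<subseteq> set R) W = [R1, R2]"
    by (simp add: W_def R)
  have own: "concat (map (\<lambda>Q. rev (filter (\<lambda>P. set P \<subseteq> set Q) W)) C) = C"
    if "set C \<subseteq> set W" for C
    using that by (induction C) (simp_all add: single)
  have "set A \<subseteq> set W" "set B \<subseteq> set W" by (auto simp: W_def)
  then have "reflect (A @ [R] @ B) W = A @ [R2, R1] @ B"
    by (simp add: reflect_def merged own)
  then show "reflect (A @ [R] @ B) (A @ [R1, R2] @ B) = A @ [R2, R1] @ B"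
    by (simp only: W_def)
qed

section \<open>Root orders continued from an arbitrary list\<close>

text \<open>The recursion of \<open>root_order\<close>, run from stage \<open>a\<close> to stage
  \<open>b\<close> on a list \<open>L\<close> that need not be a root order, since reflections
  rearrange the rows.\<close>

definition extend :: "(nat \<Rightarrow> nat) \<Rightarrow> nat \<Rightarrow> nat \<Rightarrow> nat list \<Rightarrow> nat list" where
  "extend p a b L = fold (\<lambda>x L. if p x = x then L @ [x] else rev L) [Suc a..<Suc b] L"

lemma extend_root_order: "a \<le> b \<Longrightarrow> extend p a b (root_order p a) = root_order p b"
  by (induction b rule: dec_induct) (auto simp: extend_def)

lemma extend_refl [simp]: "extend p a a L = L"
  by (simp add: extend_def)

lemma extend_first:
  "a < b \<Longrightarrow> extend p a b L = extend p (Suc a) b (if p (Suc a) = Suc a then L @ [Suc a] else rev L)"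
proof -
  assume "a < b"
  then have "[Suc a..<Suc b] = Suc a # [Suc (Suc a)..<Suc b]"
    by (simp only: upt_conv_Cons Suc_less_eq)
  then show ?thesis by (simp only: extend_def fold_Cons o_apply)
qed

lemma extend_cong:
  assumes "\<And>x. a < x \<Longrightarrow> x \<le> b \<Longrightarrow> p x = x \<longleftrightarrow> q x = x"
  shows "extend p a b L = extend q a b L"
  unfolding extend_def using assms by (intro fold_cong) auto

text \<open>Appending and reversing never tear \<open>L\<close> apart. What surrounds it, and
  whether it is reversed, depends on \<open>p\<close>, \<open>a\<close> and \<open>b\<close> only,
  whence the order of the quantifiers.\<close>

lemma extend_decomp:
  "a \<le> b \<Longrightarrow> \<exists>A B rv. \<forall>L. extend p a b L = A @ (if rv then rev L else L) @ B"
proof (induction b rule: dec_induct)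
  case base
  show ?case by (rule exI[of _ "[]"], rule exI[of _ "[]"], rule exI[of _ False]) simp
next
  case (step b)
  then obtain A B rv where IH: "\<And>L. extend p a b L = A @ (if rv then rev L else L) @ B" by blast
  have Suc: "extend p a (Suc b) L = (if p (Suc b) = Suc b then extend p a b L @ [Suc b] else rev (extend p a b L))" for L
    using step by (simp add: extend_def)
  show ?case
  proof (cases "p (Suc b) = Suc b")
    case True
    then show ?thesis
      by (intro exI[of _ A] exI[of _ "B @ [Suc b]"] exI[of _ rv]) (simp add: Suc IH)
  next
    case False
    then show ?thesis
      by (intro exI[of _ "rev B"] exI[of _ "rev A"] exI[of _ "\<not> rv"]) (simp add: Suc IH)
  qed
qed

lemma extend_permutation:
  assumes "a \<le> b" "set L = set L'" "distinct L" "distinct L'" "distinct (extend p a b L')"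
  shows "set (extend p a b L) = set (extend p a b L')" "distinct (extend p a b L)"
proof -
  obtain A B rv where "\<forall>L. extend p a b L = A @ (if rv then rev L else L) @ B"
    using extend_decomp[OF assms(1)] by blast
  then have *: "extend p a b L = A @ (if rv then rev L else L) @ B"
    "extend p a b L' = A @ (if rv then rev L' else L') @ B" by blast+
  show "set (extend p a b L) = set (extend p a b L')" using assms(2) by (simp add: *)
  show "distinct (extend p a b L)" using assms(2-5) by (simp add: * split: if_splits)
qed

section \<open>Merging two blocks, and the bubble sort\<close>

definition merge :: "(nat \<Rightarrow> nat) \<Rightarrow> nat \<Rightarrow> nat \<Rightarrow> (nat \<Rightarrow> nat)" where
  "merge p m e = (\<lambda>x. if p x = m then e else p x)"

text \<open>As \<open>e < m\<close>, the entry \<open>e\<close> stays least in the joined block, and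
  \<open>m\<close> is the only root that is lost.\<close>

lemma merge_simps:
  assumes "labelling p" "p m = m" "p e = e" "0 < e" "e < m"
  shows "labelling (merge p m e)" "nonroots (merge p m e) = insert m (nonroots p)"
proof -
  have "merge p m e x \<le> x" "merge p m e (merge p m e x) = merge p m e x"
    "0 < x \<Longrightarrow> 0 < merge p m e x" for x
    using assms(2-) labellingD(1-3)[OF assms(1), of x] by (auto simp: merge_def)
  then show "labelling (merge p m e)" by (simp add: labelling_def)
  have "merge p m e x \<noteq> x \<longleftrightarrow> x = m \<or> p x \<noteq> x" for x
    using assms(2-) labellingD(1-3)[OF assms(1), of x] by (auto simp: merge_def)
  then show "nonroots (merge p m e) = insert m (nonroots p)"
    by (auto simp: nonroots_def)
qed

lemma set_row: "set (row p m r) = {x \<in> {1..m}. p x = r}"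
  by (auto simp: row_def)

lemma rows_tableau:
  assumes "labelling p" "distinct L" "set L = {x \<in> {1..m}. p x = x}"
  shows "distinct (concat (map (row p m) L))" "[] \<notin> set (map (row p m) L)"
    "set (concat (map (row p m) L)) = {1..m}"
proof -
  have mem: "r \<in> set (row p m r)" if "r \<in> set L" for r
    using that assms(3) by (simp add: set_row)
  then show "[] \<notin> set (map (row p m) L)" by force
  have "inj_on (row p m) (set L)"
  proof (rule inj_onI)
    fix r s assume r: "r \<in> set L" and eq: "row p m r = row p m s"
    have "p r = s" using mem[OF r, unfolded eq] by (simp add: set_row)
    moreover have "p r = r" using r assms(3) by simp
    ultimately show "r = s" by simp
  qed
  then show "distinct (concat (map (row p m) L))"
  proof (intro distinct_concat)
    show "distinct xs" if "xs \<in> set (map (row p m) L)" for xs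
      using that by (auto simp: row_def)
    show "set xs \<inter> set ys = {}"
      if "xs \<in> set (map (row p m) L)" "ys \<in> set (map (row p m) L)" "xs \<noteq> ys" for xs ys
      using that by (auto simp: set_row)
  qed (use assms(2) in \<open>simp add: distinct_map\<close>)
  have "x \<in> set (row p m (p x))" "p x \<in> set L" if "x \<in> {1..m}" for x
    using that labellingD(1-3)[OF assms(1), of x] assms(3) by (auto simp: set_row)
  moreover have "set (row p m r) \<subseteq> {1..m}" for r by (auto simp: set_row)
  ultimately show "set (concat (map (row p m) L)) = {1..m}"
    unfolding set_concat set_map by fast
qed

text \<open>The rows whose roots are at most \<open>m\<close> have been reversed among themselves.\<close>

definition state :: "(nat \<Rightarrow> nat) \<Rightarrow> nat \<Rightarrow> nat \<Rightarrow> tableau" where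
  "state p n m = map (row p (Suc n)) (extend p m (Suc n) (rev (root_order p m)))"

lemma state_0: "labelling p \<Longrightarrow> state p n 0 = tab p (Suc n)"
  using extend_root_order[of 0 "Suc n" p] by (simp add: state_def tab_def)

text \<open>In the merged partition \<open>Suc m\<close> is a nonroot, so stage \<open>Suc m\<close>
  reverses the root order and yields \<open>rev B @ [e] @ rev A\<close>; the later stages are the
  same as for \<open>p\<close>. Hence \<open>U\<close> arises from \<open>S1\<close> by joining the
  adjacent rows of \<open>e\<close> and \<open>Suc m\<close>, and the reflection exchanges
  them.\<close>

lemma merge_swap:
  assumes p: "labelling p" "p (Suc m) = Suc m" "m < Suc n" and T: "root_order p m = A @ e # B"
  defines "L1 \<equiv> rev B @ [e, Suc m] @ rev A" and "L2 \<equiv> rev B @ [Suc m, e] @ rev A"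
  defines "S1 \<equiv> map (row p (Suc n)) (extend p (Suc m) (Suc n) L1)"
  defines "S2 \<equiv> map (row p (Suc n)) (extend p (Suc m) (Suc n) L2)"
  defines "U \<equiv> tab (merge p (Suc m) e) (Suc n)"
  shows "prec n S1 U" "reflect U S1 = S2"
proof -
  let ?q = "merge p (Suc m) e" and ?ext = "extend p (Suc m) (Suc n)"
  have e: "p e = e" "0 < e" "e \<le> m"
    using set_root_order[of p m] by (auto simp: T)
  then have q: "labelling ?q" "nonroots ?q = insert (Suc m) (nonroots p)"
    using p merge_simps[OF p(1,2) e(1,2)] by auto
  have root: "?q x = x \<longleftrightarrow> x \<noteq> Suc m \<and> p x = x" for x
    using q(2) by (auto simp: nonroots_def set_eq_iff)
  have "?q y = p y" if "y \<le> m" for y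
    using labellingD(1)[OF p(1), of y] that by (auto simp: merge_def)
  then have "root_order ?q m = root_order p m" by (rule root_order_cong)
  then have "root_order ?q (Suc m) = rev (root_order p m)" by (simp add: root)
  then have "root_order ?q (Suc n) = extend ?q (Suc m) (Suc n) (rev (root_order p m))"
    using extend_root_order[of "Suc m" "Suc n" ?q] p(3) by simp
  also have "\<dots> = ?ext (rev B @ [e] @ rev A)"
    using T by (subst extend_cong[of _ _ ?q p]) (auto simp: root)
  finally have U: "U = map (row ?q (Suc n)) (?ext (rev B @ [e] @ rev A))"
    by (simp add: U_def tab_def)
  obtain X Y rv where ext: "\<And>L. ?ext L = X @ (if rv then rev L else L) @ Y"
    using extend_decomp[of "Suc m" "Suc n" p] p(3) by auto
  have roots: "?ext (root_order p (Suc m)) = root_order p (Suc n)"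
    using extend_root_order[of "Suc m" "Suc n" p] p(3) by simp
  have le: "Suc m \<le> Suc n" using p(3) by simp
  have L1: "set L1 = set (root_order p (Suc m))" "distinct L1"
    using distinct_root_order[of p "Suc m"] by (auto simp: L1_def T p)
  have ext1: "set (?ext L1) = {x \<in> {1..Suc n}. p x = x}" "distinct (?ext L1)"
    using extend_permutation[OF le L1 distinct_root_order, of p, unfolded roots, OF distinct_root_order]
    by (simp_all only: set_root_order)
  note t1 = rows_tableau[OF p(1) ext1(2,1)]
  then have other: "row ?q (Suc n) r = row p (Suc n) r" if "r \<in> set (X @ rev B @ rev A @ Y)" for r
  proof -
    have "r \<noteq> e" "r \<noteq> Suc m" using that ext1(2) by (auto simp: ext L1_def split: if_splits)
    then show ?thesis by (auto simp: row_def merge_def intro!: filter_cong)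
  qed
  have merged: "set (row ?q (Suc n) e) = set (row p (Suc n) e) \<union> set (row p (Suc n) (Suc m))"
    by (auto simp: row_def merge_def)
  let ?R = "row p (Suc n)"
  \<comment> \<open>The later stages may have reversed the list, which puts the row of
    \<open>Suc m\<close> above that of \<open>e\<close>.\<close>
  have "prec n S1 U \<and> reflect U S1 = S2"
  proof (cases rv)
    case False
    have S1: "S1 = map ?R (X @ rev B) @ [?R e, ?R (Suc m)] @ map ?R (rev A @ Y)"
      by (simp add: S1_def L1_def ext False)
    have S2: "S2 = map ?R (X @ rev B) @ [?R (Suc m), ?R e] @ map ?R (rev A @ Y)"
      by (simp add: S2_def L2_def ext False)
    have U': "U = map ?R (X @ rev B) @ [row ?q (Suc n) e] @ map ?R (rev A @ Y)"
      using other by (simp add: U ext False)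
    show ?thesis
      using adjacent_rows_swap[of "map ?R (X @ rev B)" "?R e" "?R (Suc m)" "map ?R (rev A @ Y)" n "row ?q (Suc n) e"]
        t1[folded S1_def] merged unfolding S1[symmetric] S2[symmetric] U'[symmetric] by simp
  next
    case True
    have S1: "S1 = map ?R (X @ A) @ [?R (Suc m), ?R e] @ map ?R (B @ Y)"
      by (simp add: S1_def L1_def ext True)
    have S2: "S2 = map ?R (X @ A) @ [?R e, ?R (Suc m)] @ map ?R (B @ Y)"
      by (simp add: S2_def L2_def ext True)
    have U': "U = map ?R (X @ A) @ [row ?q (Suc n) e] @ map ?R (B @ Y)"
      using other by (simp add: U ext True)
    show ?thesis
      using adjacent_rows_swap[of "map ?R (X @ A)" "?R (Suc m)" "?R e" "map ?R (B @ Y)" n "row ?q (Suc n) e"]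
        t1[folded S1_def] merged unfolding S1[symmetric] S2[symmetric] U'[symmetric] by (simp add: Un_commute)
  qed
  then show "prec n S1 U" "reflect U S1 = S2" by auto
qed

lemma reflect_list_append: "reflect_list n (P @ Q) T = reflect_list n Q (reflect_list n P T)"
  by (simp add: reflect_list_def)

text \<open>The row of \<open>Suc m\<close> is exchanged in turn with each of the rows of smaller root, as in bubble sort.\<close>

lemma state_Suc_root:
  assumes p: "labelling p" "p (Suc m) = Suc m" "m < Suc n"
  shows "reflect_list n (map (\<lambda>e. tab (merge p (Suc m) e) (Suc n)) (root_order p m)) (state p n m)
    = state p n (Suc m)"
proof -
  let ?st = "\<lambda>L. map (row p (Suc n)) (extend p (Suc m) (Suc n) L)"
  \<comment> \<open>Invariant of the bubble sort: the row of \<open>Suc m\<close> has passed the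
    rows with roots in \<open>A\<close>.\<close>
  have "reflect_list n (map (\<lambda>e. tab (merge p (Suc m) e) (Suc n)) A) (?st (rev (root_order p m) @ [Suc m]))
      = ?st (rev B @ [Suc m] @ rev A)" if "root_order p m = A @ B" for A B
    using that
  proof (induction A arbitrary: B rule: rev_induct)
    case Nil
    then show ?case by (simp add: reflect_list_def)
  next
    case (snoc e A)
    then show ?case
      using merge_swap[OF p, of A e B] snoc.IH[of "e # B"]
      by (simp add: reflect_list_append) (simp add: reflect_list_def)
  qed
  from this[of "root_order p m" "[]"] show ?thesis
    using p extend_first[of m "Suc n" p] by (simp add: state_def)
qed

lemma state_Suc_nonroot:
  assumes "p (Suc m) \<noteq> Suc m" "m < Suc n"
  shows "state p n (Suc m) = state p n m"
  using assms extend_first[of m "Suc n" p] by (simp add: state_def)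

text \<open>Listed in the order of the bubble sort: by the larger root, then by the place of the
  smaller one in the root order. By \<open>sorted_merges\<close> this is the order
  \<open>before\<close>.\<close>

definition merges :: "(nat \<Rightarrow> nat) \<Rightarrow> nat \<Rightarrow> (nat \<Rightarrow> nat) list" where
  "merges p M = concat (map (\<lambda>m. if p (Suc m) = Suc m then map (merge p (Suc m)) (root_order p m) else []) [0..<M])"

lemma reflect_merges:
  assumes "labelling p" "M \<le> Suc n"
  shows "reflect_list n (map (\<lambda>q. tab q (Suc n)) (merges p M)) (tab p (Suc n)) = state p n M"
  using assms(2)
proof (induction M)
  case 0
  then show ?case using assms by (simp add: merges_def reflect_list_def state_0)
next
  case (Suc M)
  then show ?case
    using state_Suc_root[OF assms(1), of M n] state_Suc_nonroot[of p M n]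
    by (simp add: merges_def reflect_list_append comp_def) (auto simp: reflect_list_def)
qed

subsection \<open>The partitions in increasing order\<close>

text \<open>Removes the last pair \<open>(j\<^sub>k, i\<^sub>k)\<close> by making
  \<open>j\<^sub>k\<close> a root again.\<close>

definition parent :: "(nat \<Rightarrow> nat) \<Rightarrow> (nat \<Rightarrow> nat)" where
  "parent q = q(max_nonroot q := max_nonroot q)"

lemma partitionsD:
  assumes "p \<in> partitions n k"
  shows "labelling p" "nonroots p \<subseteq> {..Suc n}" "card (nonroots p) = k" "finite (nonroots p)"
  using assms finite_subset[of "nonroots p" "{..n + 1}"] by (auto simp: partitions_def)

lemma max_nonroot:
  assumes "finite (nonroots p)"
  shows "1 \<le> max_nonroot p" "\<And>x. p x \<noteq> x \<Longrightarrow> x \<le> max_nonroot p" "\<And>x. max_nonroot p < x \<Longrightarrow> p x = x"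
    "nonroots p \<noteq> {} \<Longrightarrow> labelling p \<Longrightarrow> max_nonroot p \<in> nonroots p"
proof -
  show "1 \<le> max_nonroot p" "\<And>x. p x \<noteq> x \<Longrightarrow> x \<le> max_nonroot p"
    using assms by (auto simp: max_nonroot_def nonroots_def)
  then show "\<And>x. max_nonroot p < x \<Longrightarrow> p x = x" by (metis not_le)
  assume "nonroots p \<noteq> {}" and p: "labelling p"
  then obtain x where x: "p x \<noteq> x" by (auto simp: nonroots_def)
  then have "x \<noteq> 0" "x \<noteq> Suc 0" using labellingD(4,5)[OF p] by metis+
  then have "1 < x" by simp
  moreover have "x \<le> max_nonroot p" using assms x by (simp add: max_nonroot_def nonroots_def)
  ultimately have "max_nonroot p \<noteq> 1" by simp
  moreover have "max_nonroot p \<in> insert 1 (nonroots p)"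
    using assms unfolding max_nonroot_def by (intro Max_in) auto
  ultimately show "max_nonroot p \<in> nonroots p" by simp
qed

lemma length_root_order_above:
  assumes "p \<in> partitions n k" "max_nonroot p \<le> m"
  shows "length (root_order p m) = m - k"
proof -
  have "x \<in> {1..m}" if "x \<in> nonroots p" for x
  proof -
    have "p x \<noteq> x" using that by (simp add: nonroots_def)
    then have "x \<le> max_nonroot p" "x \<noteq> 0"
      using max_nonroot(2)[OF partitionsD(4)[OF assms(1)]] labellingD(4)[OF partitionsD(1)[OF assms(1)]]
      by (blast, metis)
    then show ?thesis using assms(2) by simp
  qed
  then have "nonroots p \<inter> {1..m} = nonroots p" by blast
  then show ?thesis using length_root_order[of p m] partitionsD(3)[OF assms(1)] by simp
qed

text \<open>The new label is a root below \<open>j\<close>, and \<open>j\<close> formed a singleton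
  block because it lies above all nonroots. The code recovers \<open>i\<close> since the root order
  has no repetitions.\<close>

lemma insert_entry:
  assumes p: "p \<in> partitions n k" and j: "max_nonroot p < j" and i: "1 \<le> i" "i < j - k"
  defines "q \<equiv> insert_entry p j i"
  shows "labelling q" "nonroots q = insert j (nonroots p)" "max_nonroot q = j" "parent q = p"
    "code q j = i" "\<And>y. y \<noteq> j \<Longrightarrow> q y = p y"
proof -
  note labelling = partitionsD(1)[OF p] and fin = partitionsD(4)[OF p]
  let ?L = "rev (root_order p (j - 1))"
  have i': "i - 1 < length ?L"
    using length_root_order_above[OF p, of "j - 1"] i j by simp
  then have "?L ! (i - 1) \<in> set ?L" by (rule nth_mem)
  then have "?L ! (i - 1) \<in> {x \<in> {1..j - 1}. p x = x}"
    unfolding set_rev set_root_order .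
  then have "p (?L ! (i - 1)) = ?L ! (i - 1)" "1 \<le> ?L ! (i - 1)" "?L ! (i - 1) \<le> j - 1"
    by simp_all
  then have r: "p (?L ! (i - 1)) = ?L ! (i - 1)" "0 < ?L ! (i - 1)" "?L ! (i - 1) < j"
    using j by linarith+
  show other: "\<And>y. y \<noteq> j \<Longrightarrow> q y = p y" by (simp add: q_def insert_entry_def)
  have qj: "q j = ?L ! (i - 1)" by (simp add: q_def insert_entry_def)
  have pj: "p y = y" if "j \<le> y" for y using max_nonroot(3)[OF fin] j that by simp
  show "labelling q"
  proof (unfold labelling_def, intro allI)
    fix x
    show "q x \<le> x \<and> q (q x) = q x \<and> (0 < x \<longrightarrow> 0 < q x)"
    proof (cases "x = j")
      case True
      then show ?thesis using r qj other[of "?L ! (i - 1)"] by simp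
    next
      case False
      \<comment> \<open>An entry \<open>x\<close> with label \<open>j\<close> would lie above
        \<open>j\<close>, hence be a root, so that \<open>x = j\<close>.\<close>
      have "p x \<noteq> j" using False pj[of x] labellingD(1)[OF labelling, of x] pj[of "p x"] labellingD(2)[OF labelling, of x]
        by (metis le_neq_implies_less less_le_not_le linear)
      then show ?thesis using False labellingD(1-3)[OF labelling, of x] by (simp add: other)
    qed
  qed
  have qx: "q x \<noteq> x \<longleftrightarrow> x = j \<or> p x \<noteq> x" for x
    using r(3) qj by (cases "x = j") (auto simp: other)
  then show nr: "nonroots q = insert j (nonroots p)" by (auto simp: nonroots_def)
  have "Max (insert 1 (insert j (nonroots p))) = j"
    using fin j max_nonroot(1,2)[OF fin]
    by (intro Max_eqI) (auto simp: nonroots_def intro: less_imp_le le_less_trans)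
  then show mx: "max_nonroot q = j" by (simp add: max_nonroot_def nr)
  show "parent q = p" using pj[of j] by (auto simp: parent_def mx other fun_eq_iff)
  have "root_order q (j - 1) = root_order p (j - 1)"
    using j by (intro root_order_cong) (simp add: other)
  moreover have "q j \<noteq> j" using qx by simp
  ultimately have c: "0 < code q j" "code q j \<le> length ?L" "?L ! (code q j - 1) = ?L ! (i - 1)"
    using code_nth[OF \<open>labelling q\<close>, of j] qj by simp_all
  have "distinct ?L" by (simp add: distinct_root_order)
  then have "code q j - 1 = i - 1"
    using c i' nth_eq_iff_index_eq[of ?L "code q j - 1" "i - 1"] by simp
  then show "code q j = i" using c(1) i(1) by simp
qed

text \<open>The largest nonroot is nobody's label, so it can become a root. The remaining nonroots
  are smaller, thus at most \<open>n\<close>, which accounts for the passage from \<open>n\<close>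
  to \<open>n - 1\<close>.\<close>

lemma parent_in_partitions:
  assumes "q \<in> partitions n (Suc k)"
  shows "parent q \<in> partitions (n - 1) k" "max_nonroot q \<in> nonroots q"
    "max_nonroot (parent q) < max_nonroot q" "nonroots (parent q) = nonroots q - {max_nonroot q}"
    "insert_entry (parent q) (max_nonroot q) (code q (max_nonroot q)) = q"
proof -
  let ?j = "max_nonroot q"
  note labelling = partitionsD(1)[OF assms] and fin = partitionsD(4)[OF assms] and sub = partitionsD(2)[OF assms]
  have "nonroots q \<noteq> {}" using partitionsD(3)[OF assms] by auto
  then show j: "?j \<in> nonroots q" using max_nonroot(4)[OF fin _ labelling] by simp
  have "q x \<noteq> ?j" for x using j labellingD(2)[OF labelling, of x] by (auto simp: nonroots_def)
  then have "labelling (parent q)" using labellingD[OF labelling] by (simp add: labelling_def parent_def)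
  moreover show nr: "nonroots (parent q) = nonroots q - {?j}"
    by (auto simp: nonroots_def parent_def)
  moreover have "x < ?j" if "x \<in> nonroots (parent q)" for x
  proof -
    have "x \<noteq> ?j" "q x \<noteq> x" using that unfolding nr by (auto simp: nonroots_def)
    then show ?thesis using max_nonroot(2)[OF fin, of x] by simp
  qed
  moreover have "?j \<le> Suc n" using sub j by auto
  ultimately show "parent q \<in> partitions (n - 1) k"
    using partitionsD(3)[OF assms] fin j unfolding partitions_def by fastforce
  have "1 < ?j"
  proof -
    have "q ?j \<noteq> ?j" using j by (simp add: nonroots_def)
    then have "?j \<noteq> 0" "?j \<noteq> Suc 0" using labellingD(4,5)[OF labelling] by metis+
    then show ?thesis by simp
  qed
  then show "max_nonroot (parent q) < ?j"
    using fin \<open>\<And>x. x \<in> nonroots (parent q) \<Longrightarrow> x < ?j\<close>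
    unfolding max_nonroot_def[of "parent q"] by (subst Max_less_iff) (auto simp: nr)
  have "root_order (parent q) (?j - 1) = root_order q (?j - 1)"
    using \<open>1 < ?j\<close> by (intro root_order_cong) (auto simp: parent_def)
  moreover have "q ?j \<noteq> ?j" using j by (simp add: nonroots_def)
  ultimately have "rev (root_order (parent q) (?j - 1)) ! (code q ?j - 1) = q ?j"
    using code_nth(3)[OF labelling, of ?j] by simp
  then show "insert_entry (parent q) ?j (code q ?j) = q"
    by (simp add: insert_entry_def parent_def)
qed

lemma set_children:
  assumes "p \<in> partitions (n - 1) k"
  shows "set (children n k p) = {q \<in> partitions n (Suc k). parent q = p}"
proof (intro equalityI subsetI)
  fix q assume "q \<in> set (children n k p)"
  then obtain i j where ij: "max_nonroot p < j" "j \<le> Suc n" "1 \<le> i" "i < j - k" "q = insert_entry p j i"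
    by (fastforce simp: children_def Suc_le_eq less_Suc_eq_le simp del: upt_Suc)
  note q = insert_entry[OF assms ij(1,3,4), folded ij(5)]
  have "j \<notin> nonroots p" using max_nonroot(3)[OF partitionsD(4)[OF assms]] ij(1) by (simp add: nonroots_def)
  moreover have "x \<le> Suc n" if "x \<in> nonroots p" for x
    using that max_nonroot(2)[OF partitionsD(4)[OF assms], of x] ij(1,2) by (simp add: nonroots_def)
  ultimately show "q \<in> {q \<in> partitions n (Suc k). parent q = p}"
    using q(1,2,4) ij(2) partitionsD(3,4)[OF assms] by (auto simp: partitions_def)
next
  fix q assume "q \<in> {q \<in> partitions n (Suc k). parent q = p}"
  then have q: "q \<in> partitions n (Suc k)" and p: "p = parent q" by auto
  note P = parent_in_partitions[OF q, folded p] 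
  let ?j = "max_nonroot q"
  have "root_order p (?j - 1) = root_order q (?j - 1)"
    using P(3) by (intro root_order_cong) (auto simp: parent_def p)
  moreover have "q ?j \<noteq> ?j" using P(2) by (simp add: nonroots_def)
  moreover have "length (root_order p (?j - 1)) = ?j - 1 - k"
    using P(3) by (intro length_root_order_above[OF P(1)]) simp
  ultimately have "0 < code q ?j" "code q ?j \<le> ?j - 1 - k"
    using code_nth[OF partitionsD(1)[OF q], of ?j] by simp_all
  then have "1 \<le> code q ?j" "code q ?j < ?j - k" by simp_all
  moreover have "?j \<le> Suc n" using P(2) partitionsD(2)[OF q] by auto
  ultimately have "insert_entry p ?j (code q ?j) \<in> set (children n k p)"
    using P(3) unfolding children_def set_concat set_map image_image
    by (intro UN_I[of ?j] imageI) auto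
  then show "q \<in> set (children n k p)" using P(5) by simp
qed

lemma partitions_0: "partitions n 0 = {id}"
proof -
  have "labelling id" "nonroots id = {}" by (auto simp: labelling_def nonroots_def)
  moreover have "p = id" if "p \<in> partitions n 0" for p
    using partitionsD(3,4)[OF that] by (auto simp: nonroots_def fun_eq_iff)
  ultimately show ?thesis by (auto simp: partitions_def)
qed

lemma set_labellings: "set (labellings k n) = partitions n k"
proof (induction k arbitrary: n)
  case 0
  then show ?case by (simp add: partitions_0)
next
  case (Suc k)
  have "set (labellings (Suc k) n) = (\<Union>p\<in>partitions (n - 1) k. {q \<in> partitions n (Suc k). parent q = p})"
    by (simp add: Suc set_children)
  also have "\<dots> = partitions n (Suc k)"
    using parent_in_partitions(1) by auto
  finally show ?case .
qed

text \<open>The comparison takes place at \<open>j\<close>: either both partitions have positive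
  codes there and \<open>i' < i\<close>, or the second one still has a root there, of code
  \<open>0\<close>.\<close>

lemma before_insert_entry:
  assumes p: "p \<in> partitions n k" and "max_nonroot p < j" "1 \<le> i" "i < j - k"
    and "max_nonroot p < j'" "1 \<le> i'" "i' < j' - k" and less: "j < j' \<or> j = j' \<and> i' < i"
  shows "before (insert_entry p j i) (insert_entry p j' i')"
proof -
  note q = insert_entry[OF p assms(2-4)] and q' = insert_entry[OF p assms(5-7)]
  have "code (insert_entry p j' i') j < code (insert_entry p j i) j"
  proof (cases "j = j'")
    case True
    then show ?thesis using q(5) q'(5) less by simp
  next
    case False
    then have "insert_entry p j' i' j = j"
      using q'(6)[of j] max_nonroot(3)[OF partitionsD(4)[OF p]] assms(2) by simp
    then show ?thesis using q(5) assms(3) by (simp add: code_def)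
  qed
  moreover have "insert_entry p j i y = insert_entry p j' i' y" if "y < j" for y
    using that less q(6)[of y] q'(6)[of y] by auto
  ultimately show ?thesis unfolding before_def by blast
qed

lemma sorted_wrt_concat_map:
  assumes "sorted_wrt R xs" "\<And>x. x \<in> set xs \<Longrightarrow> sorted_wrt S (f x)"
    "\<And>x y a b. x \<in> set xs \<Longrightarrow> y \<in> set xs \<Longrightarrow> R x y \<Longrightarrow> a \<in> set (f x) \<Longrightarrow> b \<in> set (f y) \<Longrightarrow> S a b"
  shows "sorted_wrt S (concat (map f xs))"
  using assms
proof (induction xs)
  case (Cons x xs)
  have "sorted_wrt S (concat (map f xs))"
  proof (rule Cons.IH)
    show "sorted_wrt R xs" using Cons.prems(1) by simp
    show "sorted_wrt S (f y)" if "y \<in> set xs" for y using Cons.prems(2) that by simp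
    show "S a b" if "y \<in> set xs" "z \<in> set xs" "R y z" "a \<in> set (f y)" "b \<in> set (f z)" for y z a b
      using that by (intro Cons.prems(3)[of y z]) simp_all
  qed
  moreover have "S a b" if "a \<in> set (f x)" "y \<in> set xs" "b \<in> set (f y)" for a b y
    using Cons.prems(3)[of x y a b] Cons.prems(1) that by simp
  ultimately show ?case using Cons.prems(2)[of x] by (auto simp: sorted_wrt_append)
qed simp

lemma sorted_children:
  assumes "p \<in> partitions n k"
  shows "sorted_wrt before (children m k p)"
  unfolding children_def
proof (rule sorted_wrt_concat_map[where R = "(<)"])
  fix j assume "j \<in> set [Suc (max_nonroot p)..<m + 2]"
  then show "sorted_wrt before (map (insert_entry p j) (rev [1..<j - k]))"
    unfolding sorted_wrt_map sorted_wrt_rev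
    by (intro sorted_wrt_mono_rel[OF _ sorted_wrt_upt]) (auto intro!: before_insert_entry[OF assms])
qed (auto intro!: before_insert_entry[OF assms] simp del: upt_Suc)

text \<open>The first difference of the parents precedes the largest nonroots of both
  \<open>q\<close> and \<open>q'\<close>, so restoring these does not affect it.\<close>

lemma before_parent_imp_before:
  assumes q: "q \<in> partitions n (Suc k)" "q' \<in> partitions n (Suc k)" and b: "before (parent q) (parent q')"
  shows "before q q'"
proof -
  note P = parent_in_partitions[OF q(1)] and P' = parent_in_partitions[OF q(2)]
  obtain x where x: "\<And>y. y < x \<Longrightarrow> parent q y = parent q' y" "code (parent q') x < code (parent q) x"
    using b by (auto simp: before_def)
  then have nx: "x \<in> nonroots (parent q)" by (auto simp: code_def nonroots_def split: if_splits)
  then have "x \<noteq> max_nonroot q" "q x \<noteq> x" unfolding P(4) by (simp_all add: nonroots_def)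
  then have "x < max_nonroot q" using max_nonroot(2)[OF partitionsD(4)[OF q(1)], of x] by simp
  then have qx: "q y = parent q y" if "y \<le> x" for y
    using that by (simp add: parent_def)
  have "x < max_nonroot q'"
  proof (rule ccontr)
    assume "\<not> x < max_nonroot q'"
    then have le: "max_nonroot q' \<le> x" by simp
    \<comment> \<open>All nonroots of \<open>parent q'\<close> would lie below \<open>x\<close>,
      where the parents agree, while \<open>x\<close> is a further nonroot of
      \<open>parent q\<close>. But both parents have \<open>k\<close> nonroots.\<close>
    have "nonroots (parent q') \<subset> nonroots (parent q)"
    proof -
      have "y < x" if "y \<in> nonroots (parent q')" for y
        using that le max_nonroot(2)[OF partitionsD(4)[OF P'(1)], of y] P'(3) by (simp add: nonroots_def)
      then have "x \<notin> nonroots (parent q')" "nonroots (parent q') \<subseteq> nonroots (parent q)"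
        using x(1) by (auto simp: nonroots_def)
      then show ?thesis using nx by blast
    qed
    then have "card (nonroots (parent q')) < card (nonroots (parent q))"
      using partitionsD(4)[OF P(1)] by (rule psubset_card_mono[rotated])
    then show False using partitionsD(3)[OF P(1)] partitionsD(3)[OF P'(1)] by simp
  qed
  then have qx': "q' y = parent q' y" if "y \<le> x" for y
    using that by (auto simp: parent_def)
  have "code q x = code (parent q) x" "code q' x = code (parent q') x"
    using qx qx' by (auto intro!: code_cong)
  then show ?thesis unfolding before_def using x qx qx' by (intro exI[of _ x]) auto
qed

lemma sorted_labellings: "sorted_wrt before (labellings k n)"
proof (induction k arbitrary: n)
  case (Suc k)
  show ?case unfolding labellings.simps
  proof (rule sorted_wrt_concat_map[OF Suc])
    show "sorted_wrt before (children n k p)" if "p \<in> set (labellings k (n - 1))" for p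
      using that sorted_children by (simp add: set_labellings)
    show "before a b" if "p \<in> set (labellings k (n - 1))" "q \<in> set (labellings k (n - 1))" "before p q"
      "a \<in> set (children n k p)" "b \<in> set (children n k q)" for p q a b
      using that before_parent_imp_before[of a n k b] by (simp add: set_labellings set_children)
  qed
qed simp

subsection \<open>The reflections that act\<close>

lemma row_index_row_cong:
  assumes "set S \<subseteq> range (row p m)" "x \<in> {1..m}" "y \<in> {1..m}" "p x = p y"
  shows "row_index S x = row_index S y"
proof -
  have "x \<in> set R \<longleftrightarrow> y \<in> set R" if "R \<in> set S" for R
    using assms that by (auto simp: set_row)
  then have "takeWhile (\<lambda>R. x \<notin> set R) S = takeWhile (\<lambda>R. y \<notin> set R) S"
    by (intro takeWhile_cong) auto
  then show ?thesis by (simp add: row_index_def)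
qed

lemma row_index_tab_eqD:
  assumes "labelling p" "x \<in> {1..m}" "y \<in> {1..m}" "row_index (tab p m) x = row_index (tab p m) y"
  shows "p x = p y"
proof -
  have *: "row_index (tab p m) z - 1 < length (root_order p m) \<and> p z = root_order p m ! (row_index (tab p m) z - 1)"
    if z: "z \<in> {1..m}" for z
  proof -
    have "p z \<in> set (root_order p m)" "z \<in> set (row p m (p z))"
      using z labellingD(1-3)[OF assms(1), of z] by (auto simp: set_root_order set_row)
    then have "\<exists>R\<in>set (tab p m). z \<in> set R" by (auto simp: tab_def)
    from row_index_nth[OF this] show ?thesis by (simp add: tab_def set_row)
  qed
  show ?thesis using *[OF assms(2)] *[OF assms(3)] assms(4) by simp
qed

text \<open>Formulated for any arrangement \<open>S\<close> of rows of \<open>p\<close>, as the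
  tableau to be reflected keeps changing.\<close>

lemma prec_coarsens_labels:
  assumes "set S \<subseteq> range (row p (Suc n))" "prec n S (tab q (Suc n))" "labelling q"
    "x \<in> {1..Suc n}" "y \<in> {1..Suc n}" "p x = p y"
  shows "q x = q y"
proof -
  have "row_index S x = row_index S y"
    using row_index_row_cong[OF assms(1,4,5,6)] .
  then have "row_index (tab q (Suc n)) x = row_index (tab q (Suc n)) y"
    using prec_coarsens[OF assms(2), of x y] assms(4,5) by simp
  then show ?thesis using row_index_tab_eqD[OF assms(3,4,5)] by simp
qed

text \<open>A coarsening keeps every nonroot, and the numbers of nonroots differ by one. So exactly
  one root \<open>m\<close> is lost, and its block joins that of \<open>q m\<close>.\<close>

lemma coarsening_is_merge:
  assumes p: "p \<in> partitions n k" and q: "q \<in> partitions n (Suc k)"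
    and coarse: "\<And>x. x \<in> {1..Suc n} \<Longrightarrow> q x = q (p x)"
  obtains m e where "p m = m" "p e = e" "0 < e" "e < m" "q = merge p m e"
proof -
  note lp = labellingD[OF partitionsD(1)[OF p]] and lq = labellingD[OF partitionsD(1)[OF q]]
  have bound: "x \<in> {1..Suc n}" if "p x \<noteq> x \<or> q x \<noteq> x" for x
  proof -
    have "x \<le> Suc n" using that partitionsD(2)[OF p] partitionsD(2)[OF q] by (auto simp: nonroots_def)
    moreover have "x \<noteq> 0" using that lp(4) lq(4) by metis
    ultimately show ?thesis by simp
  qed
  have sub: "nonroots p \<subseteq> nonroots q"
  proof
    fix x assume "x \<in> nonroots p"
    then have "p x \<noteq> x" by (simp add: nonroots_def)
    then have "q x = q (p x)" using bound by (intro coarse) blast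
    moreover have "p x < x" using \<open>p x \<noteq> x\<close> lp(1)[of x] by simp
    ultimately show "x \<in> nonroots q" using lq(1)[of "p x"] by (simp add: nonroots_def)
  qed
  have "card (nonroots q - nonroots p) = 1"
    using partitionsD(3,4)[OF p] partitionsD(3)[OF q] sub by (simp add: card_Diff_subset)
  then obtain m where m: "nonroots q - nonroots p = {m}" by (rule card_1_singletonE)
  then have m': "p m = m" "q m \<noteq> m" and other: "p x = x \<Longrightarrow> x \<noteq> m \<Longrightarrow> q x = x" for x
    by (auto simp: nonroots_def set_eq_iff)
  have e: "q (q m) = q m" "q m < m" "0 < q m"
    using lq(1,2,3)[of m] bound[of m] m' by auto
  have root: "p (q m) = q m" using sub e(1) by (auto simp: nonroots_def)
  have "q x = merge p m (q m) x" for x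
  proof (cases "x \<in> {1..Suc n}")
    case True
    then have x: "q x = q (p x)" by (rule coarse)
    show ?thesis
    proof (cases "p x = m")
      case True
      then show ?thesis unfolding x by (simp only: merge_def if_True refl)
    next
      case False
      then have "q (p x) = p x" using other[of "p x"] lp(2)[of x] by blast
      then show ?thesis using x False by (simp add: merge_def)
    qed
  next
    case False
    then have "q x = x" "p x = x" using bound by blast+
    then show ?thesis using m' by (auto simp: merge_def)
  qed
  then have "q = merge p m (q m)" by (rule ext)
  then show ?thesis using m'(1) root e(3,2) by (intro that[of m "q m"])
qed

lemma set_merges: "set (merges p M) = {merge p m e | m e. m \<le> M \<and> p m = m \<and> p e = e \<and> 0 < e \<and> e < m}"
proof (intro equalityI subsetI)
  fix q assume "q \<in> set (merges p M)"
  then obtain m where "m < M" "q \<in> set (if p (Suc m) = Suc m then map (merge p (Suc m)) (root_order p m) else [])"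
    unfolding merges_def by auto
  moreover from this obtain e where "p (Suc m) = Suc m" "q = merge p (Suc m) e" "e \<in> set (root_order p m)"
    by (auto split: if_splits)
  ultimately show "q \<in> {merge p m e | m e. m \<le> M \<and> p m = m \<and> p e = e \<and> 0 < e \<and> e < m}"
    by (intro CollectI exI[of _ "Suc m"] exI[of _ e]) (auto simp: set_root_order)
next
  fix q assume "q \<in> {merge p m e | m e. m \<le> M \<and> p m = m \<and> p e = e \<and> 0 < e \<and> e < m}"
  then obtain m e where q: "q = merge p m e" and m: "m \<le> M" "p m = m" "p e = e" "0 < e" "e < m"
    by blast
  obtain m' where [simp]: "m = Suc m'" using m by (cases m) auto
  have "q \<in> set (map (merge p (Suc m')) (root_order p m'))"
    using m by (auto simp: q set_root_order)
  then show "q \<in> set (merges p M)"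
    using m unfolding merges_def by (auto intro!: bexI[of _ m'])
qed

lemma merge_below: "labelling p \<Longrightarrow> y < m \<Longrightarrow> merge p m e y = p y"
  using labellingD(1)[of p y] by (auto simp: merge_def)

text \<open>Place \<open>i\<close> of the root order, counted from 0, is place
  \<open>length (root_order p m) - i\<close> of its reverse, counted from 1. So the codes decrease
  along the root order.\<close>

lemma code_merge:
  assumes "labelling p" "p (Suc m) = Suc m" "i < length (root_order p m)"
  shows "code (merge p (Suc m) (root_order p m ! i)) (Suc m) = length (root_order p m) - i"
proof -
  let ?L = "root_order p m" let ?q = "merge p (Suc m) (?L ! i)"
  have "?L ! i \<in> set ?L" using assms(3) by (rule nth_mem)
  then have e: "p (?L ! i) = ?L ! i" "0 < ?L ! i" "?L ! i < Suc m" by (auto simp: set_root_order)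
  have "root_order ?q m = ?L"
    using merge_below[OF assms(1)] by (intro root_order_cong) simp
  moreover have "?q (Suc m) = ?L ! i" using assms(2) by (simp add: merge_def)
  moreover have "labelling ?q" using merge_simps(1)[OF assms(1,2) e] .
  ultimately have c: "0 < code ?q (Suc m)" "code ?q (Suc m) \<le> length ?L"
      "rev ?L ! (code ?q (Suc m) - 1) = ?L ! i"
    using code_nth[of ?q "Suc m"] e(3) by simp_all
  have "rev ?L ! (length ?L - 1 - i) = ?L ! i"
    using assms(3) by (simp add: rev_nth)
  then have "code ?q (Suc m) - 1 = length ?L - 1 - i"
    using c assms(3) nth_eq_iff_index_eq[of "rev ?L" "code ?q (Suc m) - 1" "length ?L - 1 - i"]
    by (simp add: distinct_root_order)
  then show ?thesis using c(1) assms(3) by simp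
qed

text \<open>For a fixed larger root the codes decrease along the root order; a merge at a later root
  keeps \<open>Suc m\<close> a root, of code \<open>0\<close>.\<close>

lemma sorted_merges:
  assumes "labelling p"
  shows "sorted_wrt before (merges p M)"
  unfolding merges_def
proof (rule sorted_wrt_concat_map[where R = "(<)"])
  fix m
  show "sorted_wrt before (if p (Suc m) = Suc m then map (merge p (Suc m)) (root_order p m) else [])"
  proof (cases "p (Suc m) = Suc m")
    case True
    have "before (merge p (Suc m) (root_order p m ! i)) (merge p (Suc m) (root_order p m ! j))"
      if "i < j" "j < length (root_order p m)" for i j
      unfolding before_def
    proof (intro exI[of _ "Suc m"] conjI allI impI)
      fix y assume "y < Suc m"
      then show "merge p (Suc m) (root_order p m ! i) y = merge p (Suc m) (root_order p m ! j) y"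
        by (simp only: merge_below[OF assms])
    next
      show "code (merge p (Suc m) (root_order p m ! j)) (Suc m) < code (merge p (Suc m) (root_order p m ! i)) (Suc m)"
        using that code_merge[OF assms True, of i] code_merge[OF assms True, of j] by simp
    qed
    then show ?thesis using True by (simp add: sorted_wrt_iff_nth_less)
  qed simp
next
  fix m m' a b
  assume "m < m'"
    and a: "a \<in> set (if p (Suc m) = Suc m then map (merge p (Suc m)) (root_order p m) else [])"
    and b: "b \<in> set (if p (Suc m') = Suc m' then map (merge p (Suc m')) (root_order p m') else [])"
  from a obtain i where i: "p (Suc m) = Suc m" "i < length (root_order p m)"
      "a = merge p (Suc m) (root_order p m ! i)"
    by (auto simp: in_set_conv_nth split: if_splits)
  from b obtain e where e: "b = merge p (Suc m') e" by (auto split: if_splits)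
  have "b (Suc m) = Suc m" using i(1) \<open>m < m'\<close> by (simp add: e merge_def)
  then have "code b (Suc m) < code a (Suc m)"
    using code_merge[OF assms i(1,2)] i(2,3) by (simp add: code_def)
  then show "before a b" unfolding before_def using merge_below[OF assms] \<open>m < m'\<close>
    by (intro exI[of _ "Suc m"]) (simp add: e i(3))
next
  show "sorted_wrt (<) [0..<M]" by (rule sorted_wrt_upt)
qed

lemma sorted_wrt_set_unique:
  assumes "\<And>x. \<not> P x x" "\<And>x y z. P x y \<Longrightarrow> P y z \<Longrightarrow> P x z"
    and "sorted_wrt P xs" "sorted_wrt P ys" "set xs = set ys"
  shows "xs = ys"
  using assms(3-5)
proof (induction xs arbitrary: ys)
  case (Cons x xs)
  then obtain y ys' where ys: "ys = y # ys'" by (cases ys) auto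
  have "x = y"
  proof (rule ccontr)
    assume "x \<noteq> y"
    then have "x \<in> set ys'" "y \<in> set xs" using Cons.prems(3) by (auto simp: ys)
    then have "P y x" "P x y" using Cons.prems(1,2) by (auto simp: ys)
    then show False using assms(1,2) by blast
  qed
  moreover have "x \<notin> set xs" "y \<notin> set ys'" using Cons.prems(1,2) assms(1) by (auto simp: ys)
  ultimately have "set xs = set ys'" using Cons.prems(3) by (auto simp: ys)
  then show ?case using Cons \<open>x = y\<close> by (simp add: ys)
qed simp

text \<open>A reflection only uses rows of the given tableau, so the rows stay in \<open>X\<close>,
  and the members outside \<open>Q\<close> have no effect throughout.\<close>

lemma reflect_list_filter:
  assumes "\<And>q S. q \<in> set xs \<Longrightarrow> \<not> Q q \<Longrightarrow> set S \<subseteq> X \<Longrightarrow> \<not> prec n S (f q)" "set S \<subseteq> X"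
  shows "reflect_list n (map f xs) S = reflect_list n (map f (filter Q xs)) S"
  using assms
proof (induction xs arbitrary: S)
  case (Cons q xs)
  let ?S = "if prec n S (f q) then reflect (f q) S else S"
  have "set ?S \<subseteq> X" using Cons.prems(2) by (auto simp: reflect_def)
  then have "reflect_list n (map f xs) ?S = reflect_list n (map f (filter Q xs)) ?S"
    using Cons.prems(1) by (intro Cons.IH) auto
  moreover have "Q q \<or> \<not> prec n S (f q)" using Cons.prems by auto
  ultimately show ?case by (auto simp: reflect_list_def)
qed simp

lemma partitions_mono: "m \<le> n \<Longrightarrow> partitions m k \<subseteq> partitions n k"
  by (auto simp: partitions_def)

section \<open>Merges among the children of earlier partitions\<close>

text \<open>The root \<open>m\<close> is less than the largest nonroot \<open>j\<close> of
  \<open>p\<close>, which is also the largest nonroot of the merge. Making \<open>j\<close> a root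
  changes nothing up to \<open>m\<close>, where the parent of the merge has a positive code and
  \<open>p\<close> has code \<open>0\<close>.\<close>

lemma merge_in_earlier_child:
  assumes p: "p \<in> partitions (n - 1) k" and m: "m \<le> max_nonroot p" "p m = m" "p e = e" "0 < e" "e < m"
  shows "merge p m e \<in> partitions n (Suc k)" "before (parent (merge p m e)) p"
proof -
  let ?q = "merge p m e" and ?j = "max_nonroot p"
  note labelling = partitionsD(1)[OF p] and fin = partitionsD(4)[OF p]
  note q = merge_simps[OF labelling m(2-5)]
  \<comment> \<open>Without nonroots the default value \<open>max_nonroot p = 1\<close> would
    contradict \<open>0 < e\<close> and \<open>e < m\<close>.\<close>
  have "nonroots p \<noteq> {}" using m by (auto simp: max_nonroot_def)
  then have j: "?j \<in> nonroots p" using max_nonroot(4)[OF fin _ labelling] by simp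
  then have mj: "m < ?j" using m(1,2) by (auto simp: nonroots_def le_less)
  have "?j \<le> Suc n" using j partitionsD(2)[OF p] by auto
  moreover have "x \<le> Suc n" if "x \<in> nonroots p" for x
    using that partitionsD(2)[OF p] by auto
  ultimately show qP: "?q \<in> partitions n (Suc k)"
    using q mj m(2) partitionsD(3,4)[OF p] by (auto simp: partitions_def nonroots_def)
  have "max_nonroot ?q = ?j"
    using mj fin unfolding max_nonroot_def[of ?q] q(2)
    by (intro Max_eqI) (use j max_nonroot(1,2)[OF fin] in \<open>auto simp: nonroots_def\<close>)
  then have below: "parent ?q y = ?q y" if "y \<le> m" for y
    using that mj by (simp add: parent_def)
  have "code ?q m > 0" using m by (simp add: code_def merge_def)
  moreover have "code (parent ?q) m = code ?q m" using below by (intro code_cong) simp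
  ultimately have "code p m < code (parent ?q) m" using m(2) by (simp add: code_def)
  then show "before (parent ?q) p"
    unfolding before_def using below merge_below[OF labelling] by (intro exI[of _ m]) simp
qed

text \<open>For larger \<open>m\<close> the block of \<open>m\<close> in \<open>p\<close> is a
  singleton and \<open>m\<close> becomes the largest nonroot, so the parent of the merge is
  \<open>p\<close> itself.\<close>

lemma earlier_child_is_low_merge:
  assumes p: "p \<in> partitions n k" and m: "p m = m" "p e = e" "0 < e" "e < m"
    and b: "before (parent (merge p m e)) p"
  shows "m \<le> max_nonroot p"
proof (rule ccontr)
  let ?q = "merge p m e"
  assume "\<not> m \<le> max_nonroot p"
  then have mj: "max_nonroot p < m" by simp
  note fin = partitionsD(4)[OF p] and q = merge_simps[OF partitionsD(1)[OF p] m]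
  have "max_nonroot ?q = m"
    using mj fin max_nonroot(1,2)[OF fin] unfolding max_nonroot_def[of ?q] q(2)
    by (intro Max_eqI) (auto simp: nonroots_def intro: less_imp_le le_less_trans)
  moreover have "p x \<noteq> m" if "x \<noteq> m" for x
  proof
    assume x: "p x = m"
    then have "x \<le> max_nonroot p" using that max_nonroot(2)[OF fin, of x] by simp
    then show False using labellingD(1)[OF partitionsD(1)[OF p], of x] x mj by simp
  qed
  ultimately have "parent ?q = p" using m by (auto simp: parent_def merge_def fun_eq_iff)
  then show False using b before_irrefl by simp
qed

lemma state_max_nonroot:
  assumes p: "p \<in> partitions n k"
  shows "state p n (max_nonroot p) = rev (tab p (max_nonroot p)) @ column (Suc (max_nonroot p)) (n + 2)"
proof -
  let ?M = "max_nonroot p" and ?L = "rev (root_order p (max_nonroot p))"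
  have root: "p x = x" if "?M < x" for x using max_nonroot(3)[OF partitionsD(4)[OF p]] that by simp
  have "map (row p b) (extend p ?M b ?L) = map (row p ?M) ?L @ column (Suc ?M) (Suc b)"
    "set (extend p ?M b ?L) \<subseteq> {..b}"
    if "?M \<le> b" for b
    using that
  proof (induction b rule: dec_induct)
    case (step b)
    have ext: "extend p ?M (Suc b) ?L = extend p ?M b ?L @ [Suc b]"
      using step root[of "Suc b"] by (simp add: extend_def)
    have "row p (Suc b) (Suc b) = [Suc b]"
    proof -
      have "p x \<noteq> Suc b" if "x \<le> b" for x
        using labellingD(1)[OF partitionsD(1)[OF p], of x] that by linarith
      then show ?thesis using root[of "Suc b"] step by (simp add: row_def)
    qed
    moreover have "row p (Suc b) r = row p b r" if "r \<le> b" for r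
      using root[of "Suc b"] step that by (simp add: row_def)
    ultimately have "row p (Suc b) (Suc b) = [Suc b]"
        "map (row p (Suc b)) (extend p ?M b ?L) = map (row p b) (extend p ?M b ?L)"
      using step(4) by (simp, intro map_cong refl) auto
    then show "map (row p (Suc b)) (extend p ?M (Suc b) ?L) = map (row p ?M) ?L @ column (Suc ?M) (Suc (Suc b))"
      using step(1,3) by (simp add: ext column_def)
    show "set (extend p ?M (Suc b) ?L) \<subseteq> {..Suc b}" using step by (auto simp: ext)
  next
    case base
    show "map (row p ?M) (extend p ?M ?M ?L) = map (row p ?M) ?L @ column (Suc ?M) (Suc ?M)"
      by (simp add: column_def)
    show "set (extend p ?M ?M ?L) \<subseteq> {..?M}"
      by (auto simp: set_root_order)
  qed
  moreover have "?M \<le> Suc n"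
    using partitionsD(2,4)[OF p] by (auto simp: max_nonroot_def)
  ultimately show ?thesis by (simp add: state_def tab_def rev_map)
qed

text \<open>A member that acts is a coarsening of \<open>p\<close>, hence a merge, and its larger
  root is at most \<open>max_nonroot p\<close>. Conversely all these merges occur, and the order
  forces the acting members to form the list \<open>merges\<close>, whose reflections carry out the
  bubble sort.\<close>

lemma reflect_earlier_children:
  assumes p: "p \<in> partitions (n - 1) k"
    and xs: "sorted_wrt before xs" "set xs = {q \<in> partitions n (Suc k). before (parent q) p}"
  shows "reflect_list n (map (\<lambda>q. tab q (Suc n)) xs) (tab p (Suc n))
    = rev (tab p (max_nonroot p)) @ column (Suc (max_nonroot p)) (n + 2)"
proof -
  let ?E = "merges p (max_nonroot p)"
  have pn: "p \<in> partitions n k" using p partitions_mono[of "n - 1" n k] by auto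
  note labelling = partitionsD(1)[OF p]
  have inert: "\<not> prec n S (tab q (Suc n))"
    if q: "q \<in> set xs" "q \<notin> set ?E" and S: "set S \<subseteq> range (row p (Suc n))" for q S
  proof
    assume prec: "prec n S (tab q (Suc n))"
    have qP: "q \<in> partitions n (Suc k)" and b: "before (parent q) p" using q(1) by (auto simp: xs(2))
    have "q x = q (p x)" if "x \<in> {1..Suc n}" for x
      using prec_coarsens_labels[OF S prec partitionsD(1)[OF qP] that, of "p x"] labellingD(1-3)[OF labelling, of x] that
      by auto
    then obtain m e where me: "p m = m" "p e = e" "0 < e" "e < m" "q = merge p m e"
      using coarsening_is_merge[OF pn qP] by blast
    then have "m \<le> max_nonroot p" using earlier_child_is_low_merge[OF pn me(1-4)] b by simp
    then show False using q(2) me unfolding set_merges by blast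
  qed
  have "set ?E \<subseteq> set xs"
    using merge_in_earlier_child[OF p] by (auto simp: set_merges xs(2))
  then have "set (filter (\<lambda>q. q \<in> set ?E) xs) = set ?E" by auto
  then have E: "filter (\<lambda>q. q \<in> set ?E) xs = ?E"
    using sorted_merges[OF labelling, of "max_nonroot p"] xs(1) before_irrefl before_trans
    by (intro sorted_wrt_set_unique[of before]) (auto intro: sorted_wrt_filter)
  have "max_nonroot p \<le> Suc n"
    using partitionsD(2,4)[OF pn] by (auto simp: max_nonroot_def)
  have "reflect_list n (map (\<lambda>q. tab q (Suc n)) xs) (tab p (Suc n))
      = reflect_list n (map (\<lambda>q. tab q (Suc n)) (filter (\<lambda>q. q \<in> set ?E) xs)) (tab p (Suc n))"
    using inert by (intro reflect_list_filter[where X = "range (row p (Suc n))"]) (auto simp: tab_def)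
  also have "\<dots> = state p n (max_nonroot p)"
    unfolding E using labelling \<open>max_nonroot p \<le> Suc n\<close> by (rule reflect_merges)
  also have "\<dots> = rev (tab p (max_nonroot p)) @ column (Suc (max_nonroot p)) (n + 2)"
    using pn by (rule state_max_nonroot)
  finally show ?thesis .
qed

lemma tab_cong:
  assumes "\<And>x. x \<le> m \<Longrightarrow> p x = q x"
  shows "tab p m = tab q m"
proof -
  have "row p m = row q m" using assms by (auto simp: row_def fun_eq_iff intro!: filter_cong)
  moreover have "root_order p m = root_order q m" using assms by (rule root_order_cong)
  ultimately show ?thesis by (simp add: tab_def)
qed

lemma tab_tableau:
  assumes "labelling p"
  shows "distinct (concat (tab p m))" "[] \<notin> set (tab p m)" "set (concat (tab p m)) = {1..m}"
  using rows_tableau[OF assms distinct_root_order set_root_order, of m] by (simp_all add: tab_def)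

lemma sorted_row: "sorted_wrt (<) (row p m r)"
  unfolding row_def by (intro sorted_wrt_filter sorted_wrt_upt)

lemma card_less_max_nonroot:
  assumes "p \<in> partitions n k"
  shows "k < max_nonroot p" "max_nonroot p \<le> Suc n"
proof -
  let ?M = "max_nonroot p"
  have "Suc 0 \<in> set (root_order p ?M)"
    using max_nonroot(1)[OF partitionsD(4)[OF assms]] labellingD(5)[OF partitionsD(1)[OF assms]]
    by (simp add: set_root_order)
  then have "0 < length (root_order p ?M)" by (cases "root_order p ?M") auto
  then show "k < ?M" using length_root_order_above[OF assms order_refl] by simp
  show "?M \<le> Suc n"
    using partitionsD(2,4)[OF assms] by (auto simp: max_nonroot_def)
qed

subsection \<open>Blocks\<close>

text \<open>For \<open>p\<close> the \<open>i\<close>-th member of \<open>\<pi>\<^sub>k(A\<^bsub>n-1\<^esub>)\<close> this turns out to be \<open>T\<^bsub>i,i\<^esub>\<close>.\<close>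

definition diagonal :: "nat \<Rightarrow> (nat \<Rightarrow> nat) \<Rightarrow> tableau" where
  "diagonal n p = rev (tab p (max_nonroot p)) @ column (Suc (max_nonroot p)) (n + 2)"

lemma length_tab: "length (tab p m) = length (root_order p m)"
  by (simp add: tab_def)

lemma codim_diagonal:
  assumes "p \<in> partitions n k"
  shows "length (diagonal n p) = n + 1 - k" "codim n (diagonal n p) = k"
  using card_less_max_nonroot[OF assms] length_root_order_above[OF assms order_refl]
  by (auto simp: diagonal_def codim_def column_def length_tab)

text \<open>The projection keeps the rows with root at most \<open>m + 1\<close>. The nonroot
  \<open>max_nonroot p\<close> is larger, so fewer than \<open>k\<close> nonroots remain and there
  are too many rows. This is the minimality in \<open>m_of\<close>.\<close>

lemma length_proj_diagonal:
  assumes p: "p \<in> partitions n k" and m: "m + 1 < max_nonroot p"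
  shows "m + 1 < length (proj m (diagonal n p)) + k"
proof -
  let ?M = "max_nonroot p" and ?f = "filter (\<lambda>x. x \<le> m + 1)"
  note labelling = partitionsD(1)[OF p] and fin = partitionsD(4)[OF p]
  have "filter (\<lambda>R. ?f R \<noteq> []) (column (Suc ?M) (n + 2)) = []"
    using m by (auto simp: column_def filter_empty_conv)
  moreover have "?f (row p ?M r) \<noteq> [] \<longleftrightarrow> r \<le> m + 1" if "r \<in> set (root_order p ?M)" for r
  proof -
    have "r \<in> set (row p ?M r)" "\<And>x. x \<in> set (row p ?M r) \<Longrightarrow> r \<le> x"
      using that labellingD(1)[OF labelling] by (auto simp: set_root_order set_row)
    then show ?thesis by (fastforce simp: filter_empty_conv)
  qed
  then have "filter (\<lambda>r. ?f (row p ?M r) \<noteq> []) (root_order p ?M) = filter (\<lambda>r. r \<le> m + 1) (root_order p ?M)"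
    by (intro filter_cong refl)
  ultimately have "length (proj m (diagonal n p)) = length (filter (\<lambda>r. r \<le> m + 1) (root_order p ?M))"
    by (simp add: proj_def diagonal_def filter_map comp_def tab_def flip: rev_filter del: filter_empty_conv)
  also have "\<dots> = card (set (filter (\<lambda>r. r \<le> m + 1) (root_order p ?M)))"
    by (intro distinct_card[symmetric] distinct_filter distinct_root_order)
  also have "set (filter (\<lambda>r. r \<le> m + 1) (root_order p ?M)) = set (root_order p (m + 1))"
    unfolding set_filter set_root_order using m by auto
  also have "card (set (root_order p (m + 1))) = length (root_order p (m + 1))"
    by (intro distinct_card distinct_root_order)
  finally have len: "length (proj m (diagonal n p)) = length (root_order p (m + 1))" .
  have "nonroots p \<noteq> {}" using m by (auto simp: max_nonroot_def)
  then have "?M \<in> nonroots p" using max_nonroot(4)[OF fin _ labelling] by simp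
  moreover have "?M \<notin> nonroots p \<inter> {1..m + 1}" using m by simp
  ultimately have "nonroots p \<inter> {1..m + 1} \<subset> nonroots p" by blast
  then have "card (nonroots p \<inter> {1..m + 1}) < k"
    using fin partitionsD(3)[OF p] psubset_card_mono by metis
  then show ?thesis using len length_root_order[of p "m + 1"] by linarith
qed

text \<open>Keeping the entries up to \<open>max_nonroot p\<close> removes exactly the final column.
  The shift by one arises because tableaux of index \<open>m\<close> have \<open>m + 1\<close>
  entries.\<close>

lemma m_of_diagonal:
  assumes p: "p \<in> partitions n k"
  shows "m_of n (diagonal n p) = max_nonroot p - 1"
proof -
  let ?M = "max_nonroot p"
  note labelling = partitionsD(1)[OF p] and M = card_less_max_nonroot[OF p]
  have eq: "filter (\<lambda>x. x \<le> ?M - 1 + 1) R = R" if "R \<in> set (tab p ?M)" for R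
  proof -
    have "x \<le> ?M" if "x \<in> set R" for x
      using tab_tableau(3)[OF labelling, of ?M] that \<open>R \<in> set (tab p ?M)\<close> by auto
    then show ?thesis using M by (intro filter_True) auto
  qed
  have col: "filter (\<lambda>x. x \<le> ?M - 1 + 1) R = []" if "R \<in> set (column (Suc ?M) (n + 2))" for R
    using that M by (auto simp: column_def)
  have "map (filter (\<lambda>x. x \<le> ?M - 1 + 1)) (rev (tab p ?M)) = rev (tab p ?M)"
    using eq by (intro map_idI) simp
  moreover have "filter (\<lambda>R. R \<noteq> []) (map (filter (\<lambda>x. x \<le> ?M - 1 + 1)) (column (Suc ?M) (n + 2))) = []"
    unfolding filter_empty_conv using col by auto
  moreover have "filter (\<lambda>R. R \<noteq> []) (rev (tab p ?M)) = rev (tab p ?M)"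
    using tab_tableau(2)[OF labelling, of ?M] by (intro filter_True) auto
  ultimately have proj: "proj (?M - 1) (diagonal n p) = rev (tab p ?M)"
    by (simp only: proj_def diagonal_def map_append filter_append append_Nil2)
  have "distinct (concat (rev (tab p ?M)))" "set (concat (rev (tab p ?M))) = {1..?M}"
    using rows_tableau[OF labelling, of "rev (root_order p ?M)" ?M]
    by (simp_all add: distinct_root_order set_root_order tab_def rev_map)
  moreover have "\<forall>R\<in>set (tab p ?M). sorted_wrt (<) R"
    by (simp add: tab_def sorted_row)
  moreover have "length (tab p ?M) + k = ?M"
    using length_root_order_above[OF p order_refl] M by (simp add: length_tab)
  ultimately have mem: "rev (tab p ?M) \<in> tableaux (?M - 1) k"
    using M tab_tableau(2)[OF labelling, of ?M] by (simp add: tableaux_def)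
  show ?thesis unfolding m_of_def codim_diagonal(2)[OF p]
  proof (rule Least_equality)
    show "?M - 1 \<le> n \<and> proj (?M - 1) (diagonal n p) \<in> tableaux (?M - 1) k"
      unfolding proj using mem M by auto
    fix m assume "m \<le> n \<and> proj m (diagonal n p) \<in> tableaux m k"
    then have "length (proj m (diagonal n p)) + k = m + 1" by (simp add: tableaux_def)
    then show "?M - 1 \<le> m" using length_proj_diagonal[OF p, of m] by linarith
  qed
qed

section \<open>Moves inside a block\<close>

text \<open>Here \<open>e\<close> will be a box of the final column and \<open>A\<close> the rows
  above it, which have smaller entries, so that \<open>insort\<close> appends.\<close>

lemma move_singleton:
  assumes "\<And>R. R \<in> set (A @ B) \<Longrightarrow> e \<notin> set R" "[] \<notin> set (A @ B)"
  shows "move 0 e (A @ [e] # B) = [e] # A @ B"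
    "row_index (A @ [e] # B) e = Suc (length A)"
    "1 \<le> j \<Longrightarrow> j \<le> length A \<Longrightarrow> (\<And>R. R \<in> set A \<Longrightarrow> insort e R = R @ [e])
      \<Longrightarrow> move j e (A @ [e] # B) = attach_box A j e @ B"
proof -
  have rem: "map (removeAll e) A = A" "map (removeAll e) B = B"
    using assms(1) by (auto intro!: map_idI removeAll_id)
  have ne: "filter (\<lambda>R. R \<noteq> []) A = A" "filter (\<lambda>R. R \<noteq> []) B = B"
    using assms(2) by (auto intro!: filter_True)
  show "move 0 e (A @ [e] # B) = [e] # A @ B"
    by (simp add: move_def rem ne)
  show "row_index (A @ [e] # B) e = Suc (length A)"
    using assms(1) by (intro row_index_unique) auto
  assume j: "1 \<le> j" "j \<le> length A" and snoc: "\<And>R. R \<in> set A \<Longrightarrow> insort e R = R @ [e]"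
  then have ins: "insort e (A ! (j - 1)) = A ! (j - 1) @ [e]" by simp
  have "[] \<notin> set (attach_box A j e)"
    using assms(2) set_update_subset_insert[of A "j - 1" "A ! (j - 1) @ [e]"] by (auto simp: attach_box_def)
  then have "filter (\<lambda>R. R \<noteq> []) (attach_box A j e) = attach_box A j e"
    by (intro filter_True) auto
  moreover have "(A @ [] # B)[j - 1 := insort e ((A @ [] # B) ! (j - 1))] = attach_box A j e @ [] # B"
    using j ins by (simp add: attach_box_def nth_append list_update_append)
  ultimately show "move j e (A @ [e] # B) = attach_box A j e @ B"
    using j by (simp add: move_def rem ne)
qed

text \<open>There are \<open>max_nonroot p - k\<close> rows above the final column, which starts
  with \<open>max_nonroot p + 1\<close>; hence the offset \<open>k\<close>.\<close>

lemma first_entry_diagonal: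
  assumes p: "p \<in> partitions n k" and l: "max_nonroot p < l + k" "l \<le> n + 1 - k"
  shows "first_entry (diagonal n p) l = l + k"
proof -
  let ?M = "max_nonroot p"
  have len: "length (rev (tab p ?M)) = ?M - k"
    using length_root_order_above[OF p order_refl] by (simp add: length_tab)
  have "\<not> l - 1 < ?M - k" using l(1) card_less_max_nonroot(1)[OF p] by linarith
  then have "diagonal n p ! (l - 1) = column (Suc ?M) (n + 2) ! (l - 1 - (?M - k))"
    by (simp only: diagonal_def nth_append len if_False)
  also have "\<dots> = [l + k]"
  proof -
    have i: "Suc ?M + (l - 1 - (?M - k)) = l + k" "l + k < n + 2"
      using l card_less_max_nonroot[OF p] by linarith+
    then have "[Suc ?M..<n + 2] ! (l - 1 - (?M - k)) = l + k"
      by (subst nth_upt) simp_all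
    moreover have "l - 1 - (?M - k) < length [Suc ?M..<n + 2]"
      unfolding length_upt using i by linarith
    ultimately show ?thesis by (simp only: column_def nth_map)
  qed
  finally show ?thesis by (simp add: first_entry_def)
qed

lemma diagonal_shape:
  assumes p: "p \<in> partitions n k" and e: "max_nonroot p < e" "e \<le> Suc n"
  defines "A \<equiv> rev (tab p (e - 1))" and "B \<equiv> column (e + 1) (n + 2)"
  shows "column e (n + 2) = [e] # B" "length A = e - 1 - k" "[] \<notin> set (A @ B)"
    "\<And>R. R \<in> set (A @ B) \<Longrightarrow> e \<notin> set R" "\<And>R. R \<in> set A \<Longrightarrow> insort e R = R @ [e]"
proof -
  note labelling = partitionsD(1)[OF p]
  show "column e (n + 2) = [e] # B"
    using e(2) by (simp add: column_def B_def upt_conv_Cons del: upt_Suc)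
  show "length A = e - 1 - k"
    using length_root_order_above[OF p, of "e - 1"] e by (simp add: A_def length_tab)
  show "[] \<notin> set (A @ B)"
    using tab_tableau(2)[OF labelling, of "e - 1"] by (auto simp: A_def B_def column_def)
  have le: "x < e" if "R \<in> set A" "x \<in> set R" for R x
  proof -
    have "x \<in> {1..e - 1}" using tab_tableau(3)[OF labelling, of "e - 1"] that by (auto simp: A_def)
    then show ?thesis using e(1) by auto
  qed
  then show "e \<notin> set R" if "R \<in> set (A @ B)" for R
    using that by (auto simp: B_def column_def)
  show "insort e R = R @ [e]" if "R \<in> set A" for R
  proof (rule sorted_insort_is_snoc)
    show "sorted R" using that sorted_row by (auto simp: A_def tab_def intro: strict_sorted_imp_sorted)
    show "\<forall>x\<in>set R. x \<le> e" using le[OF that] by (auto intro: less_imp_le)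
  qed
qed

text \<open>A move to a new first row extends the reversed tableau at the top, which is the same as
  appending a root at the bottom before reversing.\<close>

lemma foldl_move_diagonal:
  assumes p: "p \<in> partitions n k"
    and e: "max_nonroot p - k + 1 \<le> i" "i \<le> n + 2 - k"
  shows "foldl (\<lambda>S l. move 0 (first_entry (diagonal n p) l) S) (diagonal n p) [max_nonroot p - k + 1..<i]
    = rev (tab p (i + k - 1)) @ column (i + k) (n + 2)"
  using e
proof (induction i rule: dec_induct)
  case base
  then show ?case using card_less_max_nonroot[OF p] by (simp add: diagonal_def)
next
  case (step i)
  let ?M = "max_nonroot p"
  have M: "k < ?M" "?M < i + k" "i + k \<le> Suc n" using step card_less_max_nonroot[OF p] by linarith+
  note shape = diagonal_shape[OF p M(2,3)]
  have first: "first_entry (diagonal n p) i = i + k"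
    using M by (intro first_entry_diagonal[OF p]) auto
  have "move 0 (i + k) (rev (tab p (i + k - 1)) @ column (i + k) (n + 2))
      = [i + k] # rev (tab p (i + k - 1)) @ column (i + k + 1) (n + 2)"
    unfolding shape(1) by (rule move_singleton(1)) (use shape(3,4) in auto)
  also have "\<dots> = rev (tab p (i + k)) @ column (i + k + 1) (n + 2)"
  proof -
    have "p (i + k) = i + k" using max_nonroot(3)[OF partitionsD(4)[OF p] M(2)] .
    then have "tab p (i + k) = tab p (i + k - 1) @ [[i + k]]"
      using tab_Suc_root[OF partitionsD(1)[OF p], of "i + k - 1"] M by simp
    then show ?thesis by simp
  qed
  finally show ?case using step by (simp add: first)
qed

text \<open>Reversal followed by attachment is the effect of the nonroot \<open>e\<close>, and all
  later entries are roots.\<close>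

lemma tab_insert_entry:
  assumes p: "p \<in> partitions n k" and e: "max_nonroot p < e" "e \<le> Suc n" and j: "1 \<le> j" "j < e - k"
  shows "tab (insert_entry p e j) (Suc n) = attach_box (rev (tab p (e - 1))) j e @ column (e + 1) (n + 2)"
proof -
  let ?q = "insert_entry p e j"
  note q = insert_entry[OF p e(1) j]
  have "finite (nonroots ?q)" using q(2) partitionsD(4)[OF p] by simp
  then have root: "?q x = x" if "e < x" for x using max_nonroot(3)[of ?q x] q(3) that by simp
  have "?q e \<noteq> e" using q(2) by (auto simp: nonroots_def)
  then have "tab ?q e = attach_box (rev (tab ?q (e - 1))) j e"
    using tab_Suc_nonroot[OF q(1), of "e - 1"] e(1) q(5) by simp
  moreover have "tab ?q (e - 1) = tab p (e - 1)"
    using e(1) by (intro tab_cong q(6)) auto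
  ultimately show ?thesis
    using tab_append_column[OF q(1) e(2)] root by simp
qed

lemma map_add_const_upt: "map (\<lambda>i. i + k) [a..<b] = [a + k..<b + k]"
  by (induction b) auto

text \<open>The entry \<open>e = i + k\<close> stands in row \<open>i\<close>, and moving it to the
  rows \<open>i - 1, ..., 1\<close> gives the partitions \<open>insert_entry p e j\<close> for
  \<open>j\<close> in this order.\<close>

lemma block_diagonal:
  assumes p: "p \<in> partitions n k"
  shows "block n (n + 1 - k) (diagonal n p) = map (\<lambda>q. tab q (Suc n)) (children n k p)"
proof -
  let ?M = "max_nonroot p" and ?T = "diagonal n p"
  note M = card_less_max_nonroot[OF p]
  have a: "m_of n ?T + 1 - codim n ?T = ?M - k"
    using M by (simp add: m_of_diagonal[OF p] codim_diagonal[OF p])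
  have moves: "moves (first_entry ?T i) (foldl (\<lambda>S l. move 0 (first_entry ?T l) S) ?T [?M - k + 1..<i])
      = map (\<lambda>q. tab q (Suc n)) (map (insert_entry p (i + k)) (rev [1..<i + k - k]))"
    if i: "?M - k + 1 \<le> i" "i < n + 2 - k" for i
  proof -
    have e: "?M < i + k" "i + k \<le> Suc n" using i M by linarith+
    note shape = diagonal_shape[OF p e]
    let ?A = "rev (tab p (i + k - 1))" and ?B = "column (i + k + 1) (n + 2)"
    have ri: "row_index (?A @ [i + k] # ?B) (i + k) = i"
      using move_singleton(2)[of ?A ?B "i + k"] shape(2-4) i e by auto
    have move: "move j (i + k) (?A @ [i + k] # ?B) = tab (insert_entry p (i + k) j) (Suc n)"
      if "1 \<le> j" "j < i" for j
    proof -
      have "move j (i + k) (?A @ [i + k] # ?B) = attach_box ?A j (i + k) @ ?B"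
        by (rule move_singleton(3)) (use shape(2-5) that in auto)
      also have "\<dots> = tab (insert_entry p (i + k) j) (Suc n)"
        using that by (intro tab_insert_entry[OF p e, symmetric]) auto
      finally show ?thesis .
    qed
    have first: "first_entry ?T i = i + k" using e by (intro first_entry_diagonal[OF p]) auto
    have fold: "foldl (\<lambda>S l. move 0 (first_entry ?T l) S) ?T [?M - k + 1..<i] = ?A @ [i + k] # ?B"
      using foldl_move_diagonal[OF p i(1)] i(2) unfolding shape(1) by simp
    show ?thesis
      unfolding moves_def first fold ri map_map add_diff_cancel_right'
      by (intro map_cong refl) (use move in auto)
  qed
  have "n + 1 - k + 1 = n + 2 - k" using M by simp
  then have "block n (n + 1 - k) ?T = concat (map (\<lambda>i. map (\<lambda>q. tab q (Suc n)) (map (insert_entry p (i + k)) (rev [1..<i + k - k])))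
      [?M - k + 1..<n + 2 - k])"
    unfolding block_def Let_def a using moves by (intro arg_cong[of _ _ concat] map_cong) auto
  also have "\<dots> = map (\<lambda>q. tab q (Suc n)) (concat (map (\<lambda>j. map (insert_entry p j) (rev [1..<j - k]))
      (map (\<lambda>i. i + k) [?M - k + 1..<n + 2 - k])))"
    by (simp add: map_concat comp_def)
  also have "map (\<lambda>i. i + k) [?M - k + 1..<n + 2 - k] = [Suc ?M..<n + 2]"
    unfolding map_add_const_upt using M by simp
  finally show ?thesis by (simp only: children_def)
qed

section \<open>The recursion for the ordered sets\<close>

lemma incl_tab:
  assumes "p \<in> partitions (n - 1) k" "0 < n"
  shows "incl (n - 1) n (tab p n) = tab p (Suc n)"
proof -
  have "Suc n \<notin> nonroots p" using partitionsD(2)[OF assms(1)] assms(2) by auto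
  then show ?thesis
    using tab_Suc_root[OF partitionsD(1)[OF assms(1)], of n] assms(2)
    by (simp add: incl_def attach_below_def column_def nonroots_def)
qed

text \<open>Unrolls the recursion: once the earlier diagonal tableaux are known, passing
  \<open>j\<close> blocks means reflecting in the children of the first \<open>j\<close>
  partitions.\<close>

lemma refl_seq_labellings:
  fixes n k :: nat
  defines "P \<equiv> labellings k (n - 1)"
  assumes "0 < n" "j \<le> length P"
    and diag: "\<And>l. l < j \<Longrightarrow> refl_seq n k (map (\<lambda>p. tab p n) P) l l = diagonal n (P ! l)"
    and i: "i < length P"
  shows "refl_seq n k (map (\<lambda>p. tab p n) P) j i
    = reflect_list n (map (\<lambda>q. tab q (Suc n)) (concat (map (children n k) (take j P)))) (tab (P ! i) (Suc n))"
  using assms(3) diag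
proof (induction j)
  case 0
  have "P ! i \<in> partitions (n - 1) k" using nth_mem[OF i] by (simp add: P_def set_labellings)
  then show ?case using incl_tab \<open>0 < n\<close> i by (simp add: reflect_list_def)
next
  case (Suc j)
  have "P ! j \<in> partitions (n - 1) k"
    using nth_mem[of j P] Suc.prems(1) by (simp add: P_def set_labellings)
  then have "P ! j \<in> partitions n k" using partitions_mono[of "n - 1" n k] by auto
  then have "block n (n + 1 - k) (refl_seq n k (map (\<lambda>p. tab p n) P) j j)
      = map (\<lambda>q. tab q (Suc n)) (children n k (P ! j))"
    using Suc.prems(2)[of j] block_diagonal by simp
  moreover have "take (Suc j) P = take j P @ [P ! j]"
    using Suc.prems(1) by (simp add: take_Suc_conv_app_nth)
  moreover have "refl_seq n k (map (\<lambda>p. tab p n) P) j i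
    = reflect_list n (map (\<lambda>q. tab q (Suc n)) (concat (map (children n k) (take j P)))) (tab (P ! i) (Suc n))"
    by (rule Suc.IH) (use Suc.prems in auto)
  ultimately show ?case by (simp only: refl_seq.simps) (simp add: reflect_list_append)
qed

lemma set_take_labellings:
  assumes "i < length (labellings k n)"
  shows "set (take i (labellings k n)) = {p \<in> partitions n k. before p (labellings k n ! i)}"
proof -
  let ?P = "labellings k n"
  have before: "before (?P ! a) (?P ! b)" if "a < b" "b < length ?P" for a b
    using sorted_labellings[of k n] that by (simp add: sorted_wrt_iff_nth_less)
  show ?thesis
  proof (intro equalityI subsetI)
    fix p assume "p \<in> set (take i ?P)"
    then obtain a where "a < i" "p = ?P ! a" by (auto simp: in_set_conv_nth)
    then show "p \<in> {p \<in> partitions n k. before p (?P ! i)}"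
      using before[of a i] assms nth_mem[of a ?P] by (simp add: set_labellings)
  next
    fix p assume p: "p \<in> {p \<in> partitions n k. before p (?P ! i)}"
    then have "p \<in> set ?P" by (simp add: set_labellings)
    then obtain a where a: "a < length ?P" "p = ?P ! a" by (auto simp: in_set_conv_nth)
    have "\<not> i \<le> a"
    proof
      assume "i \<le> a"
      then have "i = a \<or> before (?P ! i) (?P ! a)" using before[of i a] a by (auto simp: le_less)
      then show False using p a before_irrefl before_trans by blast
    qed
    then show "p \<in> set (take i ?P)" using a by (auto simp: in_set_conv_nth)
  qed
qed

text \<open>By strong induction the earlier blocks consist of the children of the earlier
  partitions, and in the ordered list these are exactly the partitions \<open>before\<close> the
  current one. So \<open>reflect_earlier_children\<close> applies.\<close>

lemma refl_seq_diagonal: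
  assumes "0 < n" "i < length (labellings k (n - 1))"
  shows "refl_seq n k (map (\<lambda>p. tab p n) (labellings k (n - 1))) i i = diagonal n (labellings k (n - 1) ! i)"
  using assms(2)
proof (induction i rule: less_induct)
  case (less i)
  let ?P = "labellings k (n - 1)" let ?xs = "concat (map (children n k) (take i ?P))"
  have P: "?P ! i \<in> partitions (n - 1) k" using nth_mem[OF less.prems] by (simp add: set_labellings)
  have "refl_seq n k (map (\<lambda>p. tab p n) ?P) i i
      = reflect_list n (map (\<lambda>q. tab q (Suc n)) ?xs) (tab (?P ! i) (Suc n))"
    by (rule refl_seq_labellings) (use assms(1) less in auto)
  also have "\<dots> = diagonal n (?P ! i)"
    unfolding diagonal_def
  proof (rule reflect_earlier_children[OF P])
    have "labellings (Suc k) n = ?xs @ concat (map (children n k) (drop i ?P))"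
      unfolding labellings.simps concat_append[symmetric] map_append[symmetric] append_take_drop_id ..
    then show "sorted_wrt before ?xs"
      using sorted_labellings[of "Suc k" n] by (simp only: sorted_wrt_append)
    have "set ?xs = (\<Union>p\<in>set (take i ?P). {q \<in> partitions n (Suc k). parent q = p})"
      unfolding set_concat set_map image_image set_take_labellings[OF less.prems]
      by (intro SUP_cong refl) (simp add: set_children)
    also have "\<dots> = {q \<in> partitions n (Suc k). before (parent q) (?P ! i)}"
      unfolding set_take_labellings[OF less.prems] using parent_in_partitions(1) by auto
    finally show "set ?xs = {q \<in> partitions n (Suc k). before (parent q) (?P ! i)}" .
  qed
  finally show ?case .
qed

lemma polar_eq_labellings: "polar k n = map (\<lambda>p. tab p (Suc n)) (labellings k n)"
proof (induction k arbitrary: n)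
  case 0
  have "tab id (Suc n) = tab id 0 @ column (Suc 0) (Suc (Suc n))"
    by (rule tab_append_column) (simp_all add: labelling_def)
  then show ?case by (simp add: tab_def)
next
  case (Suc k)
  show ?case
  proof (cases "n = 0")
    case True
    \<comment> \<open>The only entry 1 is a root, so there are no nonroots.\<close>
    have "partitions 0 (Suc k) = {}"
    proof -
      have False if p: "p \<in> partitions 0 (Suc k)" for p
      proof -
        have "x \<notin> nonroots p" for x
          using partitionsD(2)[OF p] labellingD(4,5)[OF partitionsD(1)[OF p]]
          by (cases "x = 0 \<or> x = Suc 0") (auto simp: nonroots_def)
        then show False using partitionsD(3)[OF p] by (metis all_not_in_conv card.empty nat.distinct(1))
      qed
      then show ?thesis by blast
    qed
    then have "labellings (Suc k) 0 = []" using set_labellings[of "Suc k" 0] by (metis set_empty)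
    then show ?thesis using True by simp
  next
    case False
    let ?P = "labellings k (n - 1)"
    have P: "polar k (n - 1) = map (\<lambda>p. tab p n) ?P" using Suc.IH[of "n - 1"] False by simp
    have "block n (n + 1 - k) (refl_seq n k (polar k (n - 1)) i i)
        = map (\<lambda>q. tab q (Suc n)) (children n k (?P ! i))" if "i < length ?P" for i
    proof -
      have "?P ! i \<in> partitions n k"
        using nth_mem[OF that] partitions_mono[of "n - 1" n k] by (auto simp: set_labellings)
      then show ?thesis unfolding P using refl_seq_diagonal[of n i k] that False block_diagonal by simp
    qed
    moreover have "length (polar k (n - 1)) = length ?P" unfolding P by simp
    ultimately have "polar (Suc k) n = concat (map (\<lambda>i. map (\<lambda>q. tab q (Suc n)) (children n k (?P ! i))) [0..<length ?P])"
      using False unfolding polar.simps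
      by (simp only: if_False) (intro arg_cong[of _ _ concat] map_cong refl, simp)
    also have "\<dots> = concat (map (\<lambda>p. map (\<lambda>q. tab q (Suc n)) (children n k p)) (map (\<lambda>i. ?P ! i) [0..<length ?P]))"
      by (simp add: comp_def)
    also have "\<dots> = map (\<lambda>q. tab q (Suc n)) (labellings (Suc k) n)"
      unfolding map_nth by (simp add: map_concat comp_def)
    finally show ?thesis .
  qed
qed

section \<open>Positions in the ordered sets\<close>

text \<open>The rows determine the labels: \<open>x\<close> and \<open>s x\<close> share a row of
  the common tableau, so \<open>r x = r (s x)\<close>, which is at most \<open>s x\<close>; then the
  roles are exchanged.\<close>

lemma tab_inj:
  assumes p: "p \<in> partitions n k" and q: "q \<in> partitions n k" and eq: "tab p (Suc n) = tab q (Suc n)"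
  shows "p = q"
proof -
  have le: "r x \<le> s x"
    if r: "r \<in> partitions n k" and s: "s \<in> partitions n k" and "tab r (Suc n) = tab s (Suc n)"
      and x: "x \<in> {1..Suc n}" for r s x
  proof -
    note lr = labellingD[OF partitionsD(1)[OF r]] and ls = labellingD[OF partitionsD(1)[OF s]]
    have sx: "s x \<in> {1..Suc n}" using x ls(1,3)[of x] by auto
    have "row_index (tab s (Suc n)) x = row_index (tab s (Suc n)) (s x)"
      by (rule row_index_row_cong[where p = s, OF _ x sx]) (auto simp: tab_def ls(2))
    then have "r x = r (s x)"
      using row_index_tab_eqD[OF partitionsD(1)[OF r] x sx] that(3) by simp
    then show ?thesis using lr(1)[of "s x"] by simp
  qed
  show ?thesis
  proof
    fix x
    show "p x = q x"
    proof (cases "x \<in> {1..Suc n}")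
      case True
      then show ?thesis using le[OF p q eq True] le[OF q p eq[symmetric] True] by simp
    next
      case False
      then have "x = 0 \<or> x \<notin> {..Suc n}" by auto
      then have "x \<notin> nonroots p" "x \<notin> nonroots q"
        using partitionsD(2)[OF p] partitionsD(2)[OF q] labellingD(4)[OF partitionsD(1)[OF p]]
          labellingD(4)[OF partitionsD(1)[OF q]] by (auto simp: nonroots_def)
      then show ?thesis by (simp add: nonroots_def)
    qed
  qed
qed

text \<open>The list \<open>labellings\<close> is strictly ordered and a tableau determines its
  partition, so positions compare as partitions do.\<close>

lemma precedes_polar_iff:
  assumes "p \<in> partitions n k" "q \<in> partitions n k"
  shows "precedes (polar k n) (tab p (Suc n)) (tab q (Suc n)) \<longleftrightarrow> before p q"
proof
  let ?P = "labellings k n"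
  have sorted: "before (?P ! a) (?P ! b)" if "a < b" "b < length ?P" for a b
    using sorted_labellings[of k n] that by (simp add: sorted_wrt_iff_nth_less)
  {
    assume "precedes (polar k n) (tab p (Suc n)) (tab q (Suc n))"
    then obtain a b where ab: "a < b" "b < length ?P"
      "tab (?P ! a) (Suc n) = tab p (Suc n)" "tab (?P ! b) (Suc n) = tab q (Suc n)"
      by (auto simp: precedes_def polar_eq_labellings)
    then have "?P ! a \<in> partitions n k" "?P ! b \<in> partitions n k"
      using nth_mem[of a ?P] nth_mem[of b ?P] by (simp_all add: set_labellings)
    then have "?P ! a = p" "?P ! b = q" using ab tab_inj assms by blast+
    then show "before p q" using sorted ab by blast
  }
  assume less: "before p q"
  obtain a b where ab: "a < length ?P" "p = ?P ! a" "b < length ?P" "q = ?P ! b"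
    using assms by (auto simp: in_set_conv_nth simp flip: set_labellings)
  have "a < b"
  proof (rule ccontr)
    assume "\<not> a < b"
    then have "a = b \<or> before q p" using sorted[of b a] ab by (auto simp: not_less le_less)
    then show False using less ab before_irrefl before_trans by blast
  qed
  then show "precedes (polar k n) (tab p (Suc n)) (tab q (Suc n))"
    unfolding precedes_def polar_eq_labellings using ab by (intro exI[of _ a] exI[of _ b]) simp
qed

subsection \<open>The iterated form\<close>

text \<open>By induction on \<open>t\<close>: the entries strictly between consecutive values of
  \<open>jval\<close> are roots and form a column, and each value itself acts as in
  \<open>tab_Suc_nonroot\<close>.\<close>

lemma iter_form_eq_tab:
  assumes "labelling p" "t \<le> length ps"
    and inc: "\<And>s. s \<le> t \<Longrightarrow> jval n ps s < jval n ps (Suc s)"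
    and gap: "\<And>s x. s \<le> t \<Longrightarrow> jval n ps s < x \<Longrightarrow> x < jval n ps (Suc s) \<Longrightarrow> p x = x"
    and entry: "\<And>s. s < t \<Longrightarrow> p (jval n ps (Suc s)) \<noteq> jval n ps (Suc s)
      \<and> code p (jval n ps (Suc s)) = ival ps (Suc s)"
  shows "iter_form n ps t = tab p (jval n ps (Suc t) - 1)"
  using assms(2-)
proof (induction t)
  case 0
  have "jval n ps 0 = 0" by (simp add: jval_def)
  then have "p x = x" if "0 < x" "x \<le> jval n ps 1 - 1" for x
    using "0.prems"(3)[of 0 x] that by simp
  then have "tab p (jval n ps 1 - 1) = tab p 0 @ column (Suc 0) (Suc (jval n ps 1 - 1))"
    by (intro tab_append_column[OF assms(1)]) auto
  then show ?case
    using "0.prems"(2)[of 0] \<open>jval n ps 0 = 0\<close> by (simp add: col_piece_def tab_def)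
next
  case (Suc t)
  let ?j = "jval n ps (Suc t)" and ?j' = "jval n ps (Suc (Suc t))"
  have IH: "iter_form n ps t = tab p (?j - 1)"
  proof (rule Suc.IH)
    show "t \<le> length ps" using Suc.prems(1) by simp
    show "jval n ps s < jval n ps (Suc s)" if "s \<le> t" for s using Suc.prems(2) that by simp
    show "p x = x" if "s \<le> t" "jval n ps s < x" "x < jval n ps (Suc s)" for s x
      using Suc.prems(3)[of s] that by simp
    show "p (jval n ps (Suc s)) \<noteq> jval n ps (Suc s) \<and> code p (jval n ps (Suc s)) = ival ps (Suc s)"
      if "s < t" for s
      using Suc.prems(4) that by simp
  qed
  have j: "0 < ?j" "?j < ?j'" using Suc.prems(2)[of t] Suc.prems(2)[of "Suc t"] by auto
  have "tab p ?j = attach_box (rev (tab p (?j - 1))) (code p ?j) ?j"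
    using tab_Suc_nonroot[OF assms(1), of "?j - 1"] Suc.prems(4)[of t] j(1) by simp
  moreover have "tab p (?j' - 1) = tab p ?j @ column (Suc ?j) (Suc (?j' - 1))"
    by (rule tab_append_column[OF assms(1)]) (use j Suc.prems(3)[of "Suc t"] in auto)
  ultimately show ?case
    using j Suc.prems(4)[of t] by (simp add: IH attach_below_def opposite_def col_piece_def)
qed

lemma jval_strict_mono:
  assumes "sorted_wrt (<) (map fst ps)" "\<forall>j\<in>set (map fst ps). 0 < j \<and> j \<le> n + 1"
    and "s < t" "t \<le> Suc (length ps)"
  shows "jval n ps s < jval n ps t"
proof -
  have "sorted_wrt (<) (0 # map fst ps @ [n + 2])"
    using assms(1,2) by (auto simp: sorted_wrt_append)
  then show ?thesis unfolding jval_def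
    by (rule sorted_wrt_nth_less) (use assms(3,4) in auto)
qed

lemma jval_Suc: "s < length ps \<Longrightarrow> jval n ps (Suc s) = fst (ps ! s)"
  by (simp add: jval_def nth_append)

lemma jval_gap:
  assumes "sorted_wrt (<) (map fst ps)" "\<forall>j\<in>set (map fst ps). 0 < j \<and> j \<le> n + 1"
    and t: "t \<le> length ps" and x: "jval n ps t < x" "x < jval n ps (Suc t)"
  shows "x \<notin> set (map fst ps)"
proof
  assume "x \<in> set (map fst ps)"
  then obtain s where s: "s < length ps" "x = jval n ps (Suc s)"
    by (auto simp: in_set_conv_nth jval_Suc)
  consider "Suc s = t" | "Suc s < t" | "s = t" | "Suc t < Suc s" by linarith
  then show False
  proof cases
    case 2
    then show ?thesis using jval_strict_mono[OF assms(1,2) 2] t x s by simp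
  next
    case 4
    then show ?thesis using jval_strict_mono[OF assms(1,2) 4] s x by simp
  qed (use s x in auto)
qed

lemma map_fst_code_seq: "map fst (code_seq p n) = filter (\<lambda>x. p x \<noteq> x) [1..<n + 2]"
  by (simp add: code_seq_def comp_def)

lemma code_seq_facts:
  assumes "p \<in> partitions n k"
  shows "sorted_wrt (<) (map fst (code_seq p n))" "set (map fst (code_seq p n)) = nonroots p"
    "\<forall>j\<in>set (map fst (code_seq p n)). 1 < j \<and> j \<le> n + 1" "length (code_seq p n) = k"
proof -
  show sorted: "sorted_wrt (<) (map fst (code_seq p n))"
    unfolding map_fst_code_seq by (intro sorted_wrt_filter sorted_wrt_upt)
  have bounds: "1 < x \<and> x \<le> n + 1" if "p x \<noteq> x" for x
  proof -
    have "x \<noteq> 0" "x \<noteq> Suc 0" using that labellingD(4,5)[OF partitionsD(1)[OF assms]] by metis+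
    moreover have "x \<le> Suc n" using that partitionsD(2)[OF assms] by (auto simp: nonroots_def)
    ultimately show ?thesis by simp
  qed
  then show set: "set (map fst (code_seq p n)) = nonroots p"
    unfolding map_fst_code_seq by (fastforce simp: nonroots_def simp del: upt_Suc)
  then show "\<forall>j\<in>set (map fst (code_seq p n)). 1 < j \<and> j \<le> n + 1"
    using bounds by (simp only: nonroots_def mem_Collect_eq) blast
  have "distinct (map fst (code_seq p n))" unfolding map_fst_code_seq by simp
  then have "length (map fst (code_seq p n)) = card (nonroots p)"
    using distinct_card set by metis
  then show "length (code_seq p n) = k" using partitionsD(3)[OF assms] by simp
qed

lemma code_seq_nth:
  assumes "s < length (code_seq p n)"
  shows "ival (code_seq p n) (Suc s) = code p (jval n (code_seq p n) (Suc s))"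
    "p (jval n (code_seq p n) (Suc s)) \<noteq> jval n (code_seq p n) (Suc s)"
proof -
  have "fst (code_seq p n ! s) \<in> set (map fst (code_seq p n))" using assms by simp
  then have "p (fst (code_seq p n ! s)) \<noteq> fst (code_seq p n ! s)" unfolding map_fst_code_seq by (simp del: upt_Suc)
  then show "p (jval n (code_seq p n) (Suc s)) \<noteq> jval n (code_seq p n) (Suc s)"
    using assms by (simp add: jval_Suc)
  show "ival (code_seq p n) (Suc s) = code p (jval n (code_seq p n) (Suc s))"
  proof -
    have "code_seq p n ! s \<in> set (code_seq p n)" using assms by (rule nth_mem)
    then obtain x where "code_seq p n ! s = (x, code p x)" by (auto simp: code_seq_def simp del: upt_Suc)
    then show ?thesis using assms by (simp add: jval_Suc ival_def)
  qed
qed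

lemma iter_form_code_seq:
  assumes p: "p \<in> partitions n k" and t: "t \<le> k"
  shows "iter_form n (code_seq p n) t = tab p (jval n (code_seq p n) (Suc t) - 1)"
proof (rule iter_form_eq_tab)
  note f = code_seq_facts[OF p]
  have pos: "\<forall>j\<in>set (map fst (code_seq p n)). 0 < j \<and> j \<le> n + 1" using f(3) by force
  show "labelling p" using partitionsD(1)[OF p] .
  show "t \<le> length (code_seq p n)" using f(4) t by simp
  show "jval n (code_seq p n) s < jval n (code_seq p n) (Suc s)" if "s \<le> t" for s
    using jval_strict_mono[OF f(1) pos, of s "Suc s"] that t f(4) by simp
  show "p x = x" if "s \<le> t" "jval n (code_seq p n) s < x" "x < jval n (code_seq p n) (Suc s)" for s x
    using jval_gap[OF f(1) pos _ that(2,3)] that(1) t f(2,4) by (simp add: nonroots_def)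
  show "p (jval n (code_seq p n) (Suc s)) \<noteq> jval n (code_seq p n) (Suc s)
      \<and> code p (jval n (code_seq p n) (Suc s)) = ival (code_seq p n) (Suc s)" if "s < t" for s
    using code_seq_nth[of s p n] that t f(4) by simp
qed

lemma full_form_code_seq:
  assumes p: "p \<in> partitions n k"
  shows "full_form n (code_seq p n) = tab p (Suc n)"
proof -
  have "jval n (code_seq p n) (Suc k) = n + 2" using code_seq_facts(4)[OF p] by (simp add: jval_def nth_append)
  then show ?thesis using iter_form_code_seq[OF p order_refl] code_seq_facts(4)[OF p] by (simp add: full_form_def)
qed

lemma admissible_code_seq:
  assumes p: "p \<in> partitions n k"
  shows "admissible n k (code_seq p n)"
proof -
  note f = code_seq_facts[OF p]
  have "1 \<le> ival (code_seq p n) t \<and> ival (code_seq p n) t \<le> length (opposite (iter_form n (code_seq p n) (t - 1)))"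
    if t: "t \<in> {1..k}" for t
  proof -
    obtain s where s: "t = Suc s" "s < length (code_seq p n)" using t f(4) by (cases t) auto
    have "iter_form n (code_seq p n) s = tab p (jval n (code_seq p n) (Suc s) - 1)"
      using iter_form_code_seq[OF p, of s] s f(4) by simp
    then show ?thesis
      using code_nth(1,2)[OF partitionsD(1)[OF p] code_seq_nth(2)[OF s(2)]]
      by (simp add: s(1) code_seq_nth(1)[OF s(2)] opposite_def length_tab)
  qed
  then show ?thesis using f by (simp add: admissible_def)
qed

text \<open>The pairs are inserted one by one. At each step the iterated form so far is the tableau
  of the partition so far, so the bound on \<open>i\<close> in \<open>admissible\<close> is the
  number of roots below \<open>j\<close>, as \<open>insert_entry\<close> requires.\<close>

lemma admissible_imp_code_seq:
  assumes adm: "admissible n k ps"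
  obtains p where "p \<in> partitions n k" "ps = code_seq p n"
proof -
  have len: "length ps = k" and sorted: "sorted_wrt (<) (map fst ps)"
    and range: "\<forall>j\<in>set (map fst ps). 1 < j \<and> j \<le> n + 1"
    and iv: "\<And>t. t \<in> {1..k} \<Longrightarrow> 1 \<le> ival ps t \<and> ival ps t \<le> length (opposite (iter_form n ps (t - 1)))"
    using adm by (auto simp: admissible_def)
  have pos: "\<forall>j\<in>set (map fst ps). 0 < j \<and> j \<le> n + 1" using range by force
  have "\<exists>p \<in> partitions n t. nonroots p = fst ` set (take t ps) \<and> (\<forall>s<t. code p (fst (ps ! s)) = snd (ps ! s))"
    if "t \<le> k" for t
    using that
  proof (induction t)
    case 0
    then show ?case by (simp add: partitions_0 nonroots_def)
  next
    case (Suc t)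
    then obtain p where p: "p \<in> partitions n t" "nonroots p = fst ` set (take t ps)"
      "\<And>s. s < t \<Longrightarrow> code p (fst (ps ! s)) = snd (ps ! s)" by auto
    define j where "j = fst (ps ! t)"
    define i where "i = snd (ps ! t)"
    have t: "t < length ps" using Suc.prems len by simp
    have earlier: "fst (ps ! s) < j" if "s < t" for s
      using sorted_wrt_nth_less[OF sorted that] t that by (simp add: j_def)
    have j: "1 < j" "j \<le> n + 1" using range t by (auto simp: j_def)
    have "x < j" if "x \<in> nonroots p" for x
    proof -
      from that obtain y where y: "y \<in> set (take t ps)" "x = fst y" unfolding p(2) by blast
      then obtain s where "s < t" "y = ps ! s" using t by (auto simp: in_set_conv_nth)
      then show ?thesis using earlier y(2) by simp
    qed
    then have mj: "max_nonroot p < j"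
      using partitionsD(4)[OF p(1)] j by (simp add: max_nonroot_def)
    have "iter_form n ps t = tab p (jval n ps (Suc t) - 1)"
    proof (rule iter_form_eq_tab)
      show "labelling p" using partitionsD(1)[OF p(1)] .
      show "t \<le> length ps" using t by simp
      show "jval n ps s < jval n ps (Suc s)" if "s \<le> t" for s
        using jval_strict_mono[OF sorted pos, of s "Suc s"] that t by simp
      show "p x = x" if "s \<le> t" "jval n ps s < x" "x < jval n ps (Suc s)" for s x
      proof -
        have "x \<notin> fst ` set ps" using jval_gap[OF sorted pos _ that(2,3)] that(1) t by simp
        then have "x \<notin> nonroots p" unfolding p(2) using set_take_subset[of t ps] by blast
        then show ?thesis by (simp add: nonroots_def)
      qed
      show "p (jval n ps (Suc s)) \<noteq> jval n ps (Suc s) \<and> code p (jval n ps (Suc s)) = ival ps (Suc s)"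
        if "s < t" for s
      proof -
        have "ps ! s \<in> set (take t ps)" using that t by (auto simp: in_set_conv_nth)
        then have "fst (ps ! s) \<in> nonroots p" unfolding p(2) by (rule imageI)
        then show ?thesis using p(3)[OF that] that t by (simp add: jval_Suc ival_def nonroots_def)
      qed
    qed
    then have "1 \<le> i" "i \<le> length (root_order p (j - 1))"
      using iv[of "Suc t"] Suc.prems t by (simp_all add: i_def j_def jval_Suc ival_def opposite_def length_tab)
    then have i: "1 \<le> i" "i < j - t"
      using length_root_order_above[OF p(1), of "j - 1"] mj by auto
    let ?q = "insert_entry p j i"
    note q = insert_entry[OF p(1) mj i]
    have "j \<notin> nonroots p" using \<open>\<And>x. x \<in> nonroots p \<Longrightarrow> x < j\<close> by blast
    then have "?q \<in> partitions n (Suc t)"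
      using q(1,2) partitionsD[OF p(1)] j by (auto simp: partitions_def)
    moreover have "nonroots ?q = fst ` set (take (Suc t) ps)"
      unfolding q(2) p(2) using t by (simp add: take_Suc_conv_app_nth j_def)
    moreover have "code ?q (fst (ps ! s)) = snd (ps ! s)" if "s < Suc t" for s
    proof (cases "s = t")
      case True
      then show ?thesis using q(5) by (simp add: j_def i_def)
    next
      case False
      then have "s < t" using that by simp
      have "code ?q (fst (ps ! s)) = code p (fst (ps ! s))"
        using earlier[OF \<open>s < t\<close>] by (intro code_cong q(6)) auto
      then show ?thesis using p(3)[OF \<open>s < t\<close>] by simp
    qed
    ultimately show ?case by blast
  qed
  from this[of k] obtain p where p: "p \<in> partitions n k" "nonroots p = fst ` set ps"
    "\<And>s. s < k \<Longrightarrow> code p (fst (ps ! s)) = snd (ps ! s)"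
    using len by auto
  have fst: "map fst ps = map fst (code_seq p n)"
    using code_seq_facts(1,2)[OF p(1)] sorted p(2)
    by (intro sorted_wrt_set_unique[of "(<)"]) auto
  have "ps = map (\<lambda>x. (x, code p x)) (map fst ps)"
    using p(3) len by (intro nth_equalityI) auto
  also have "\<dots> = code_seq p n" unfolding fst map_fst_code_seq by (simp only: code_seq_def)
  finally show ?thesis using that p(1) by blast
qed

section \<open>Comparison with the lexicographic order\<close>

text \<open>Below the first difference \<open>x\<close> the sequences agree, and then
  \<open>p\<close> has the pair \<open>(x, code p x)\<close>. The next pair of \<open>q\<close> has
  either the same entry and a smaller code, or a larger entry.\<close>

lemma before_imp_lexord:
  assumes p: "p \<in> partitions n k" and q: "q \<in> partitions n k" and less: "before p q"
  shows "(code_seq p n, code_seq q n) \<in> lexord pair_order"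
proof -
  obtain x where x: "\<And>y. y < x \<Longrightarrow> p y = q y" "code q x < code p x"
    using less by (auto simp: before_def)
  have px: "p x \<noteq> x" using x(2) by (auto simp: code_def)
  then have "x \<in> set (map fst (code_seq p n))" using code_seq_facts(2)[OF p] by (simp add: nonroots_def)
  then have xn: "1 \<le> x" "x < n + 2" unfolding map_fst_code_seq by (auto simp del: upt_Suc)
  let ?f = "\<lambda>p xs. map (\<lambda>x. (x, code p x)) (filter (\<lambda>x. p x \<noteq> x) xs)"
  have split: "[1..<n + 2] = [1..<x] @ x # [Suc x..<n + 2]"
    using upt_add_eq_append[of 1 x "n + 2 - x"] xn upt_conv_Cons[of x "n + 2"] by (simp del: upt_Suc)
  have "?f p [1..<x] = ?f q [1..<x]"
  proof -
    have "filter (\<lambda>x. p x \<noteq> x) [1..<x] = filter (\<lambda>x. q x \<noteq> x) [1..<x]"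
      using x(1) by (intro filter_cong) auto
    moreover have "code p y = code q y" if "y < x" for y
      using that x(1) by (intro code_cong) auto
    ultimately show ?thesis by simp
  qed
  then have P: "code_seq p n = ?f q [1..<x] @ (x, code p x) # ?f p [Suc x..<n + 2]"
    using px by (simp only: code_seq_def split) simp
  have Q: "code_seq q n = ?f q [1..<x] @ ?f q [x..<n + 2]"
    using xn by (simp only: code_seq_def split filter_append map_append upt_conv_Cons)
  \<comment> \<open>There is a next pair of \<open>q\<close> because both sequences have length
    \<open>k\<close>; so neither sequence is a proper prefix of the other.\<close>
  have "length (code_seq p n) = length (code_seq q n)" using code_seq_facts(4)[OF p] code_seq_facts(4)[OF q] by simp
  then have "?f q [x..<n + 2] \<noteq> []"
    unfolding P Q length_append length_Cons by force
  then obtain z w where w: "?f q [x..<n + 2] = z # w" unfolding neq_Nil_conv by (elim exE) (rule that)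
  have "z \<in> set (?f q [x..<n + 2])" unfolding w by simp
  then obtain y where y: "z = (y, code q y)" "x \<le> y" by (auto simp del: upt_Suc)
  have "((x, code p x), z) \<in> pair_order"
    using x(2) y by (cases "x = y") (auto simp: pair_order_def)
  then show ?thesis
    unfolding P Q w by (intro lexord_append_leftI) (simp only: lexord_cons_cons simp_thms)
qed

text \<open>The converse holds because \<open>before\<close> is total and the lexicographic order is
  asymmetric.\<close>

lemma before_iff_lexord:
  assumes p: "p \<in> partitions n k" and q: "q \<in> partitions n k"
  shows "(code_seq p n, code_seq q n) \<in> lexord pair_order \<longleftrightarrow> before p q"
proof
  have "asym pair_order" by (auto simp: asym_iff pair_order_def)
  then have asym: "asym (lexord pair_order)" by (rule lexord_asym)
  assume lex: "(code_seq p n, code_seq q n) \<in> lexord pair_order"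
  show "before p q"
  proof (rule ccontr)
    assume "\<not> before p q"
    then have "p = q \<or> before q p" using before_total partitionsD(1) p q by blast
    then have "(code_seq q n, code_seq p n) \<in> lexord pair_order" using lex before_imp_lexord[OF q p] by auto
    then show False using lex asym by (meson asymD)
  qed
qed (rule before_imp_lexord[OF p q])

theorem proposition6p4:
  fixes n k :: nat
  shows "(\<forall>T \<in> tableaux n k. T \<in> set (polar k n) \<longleftrightarrow> (\<exists>ps. admissible n k ps \<and> T = full_form n ps))
    \<and> (\<forall>ps qs. admissible n k ps \<longrightarrow> admissible n k qs \<longrightarrow>
         (precedes (polar k n) (full_form n ps) (full_form n qs) \<longleftrightarrow> (ps, qs) \<in> lexord pair_order))"
proof (intro conjI ballI allI impI)
  fix T
  show "T \<in> set (polar k n) \<longleftrightarrow> (\<exists>ps. admissible n k ps \<and> T = full_form n ps)"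
    unfolding polar_eq_labellings set_map set_labellings
    by (metis (no_types, lifting) admissible_imp_code_seq admissible_code_seq full_form_code_seq imageE imageI)
next
  fix ps qs
  assume "admissible n k ps" "admissible n k qs"
  then obtain p q where "p \<in> partitions n k" "ps = code_seq p n" "q \<in> partitions n k" "qs = code_seq q n"
    by (metis admissible_imp_code_seq)
  then show "precedes (polar k n) (full_form n ps) (full_form n qs) \<longleftrightarrow> (ps, qs) \<in> lexord pair_order"
    by (simp add: full_form_code_seq precedes_polar_iff before_iff_lexord)
qed

end
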